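(* Let $a\ge b\ge 1$ be integers, let $\beta>1$ be the positive root of $\beta^2=a\beta+b$, and let $\beta'=a-\beta$ be its Galois conjugate. Suppose that $a>\frac{1+\sqrt5}{2}b$, or $a=b$, or $\gcd(a,b)=1$. Then \[ \gamma(\beta)=\max\Big\{0,\;1+\inf_{j\in\mathbb Z}P_{\mathbf h(j)}(\beta')\Big\}. \]
   Context: For a real $\beta>1$, the $\beta$-transformation is $T:[0,1)\to[0,1)$, $T(x)=\beta x-\lfloor \beta x\rfloor$, and the (Rényi) $\beta$-expansion of $x\in[0,1)$ is the infinite digit string $x_1x_2x_3\cdots$ with $x_j=\lfloor \beta T^{j-1}x\rfloor$. It is purely periodic if there is $p\ge1$ with $x_{k+p}=x_k$ for all $k\ge1$. For a Pisot number $\beta$ with norm $N(\beta)$, set $b=|N(\beta)|$ and define $\gamma(\beta)=\inf\big(\{p/q\in\mathbb Q\cap[0,1): \gcd(q,b)=1,\ p/q \text{ does not have a purely periodic }\beta\text{-expansion}\}\cup\{1\}\big)$. For an algebraic integer $\beta$, the $\beta$-adic expansion of $x\in\mathbb Z[\beta]$ is the unique infinite word $\mathbf h(x)=u_0u_1u_2\cdots$ with $u_n\in\{0,1,\dots,|N(\beta)|-1\}$ such that $x-\sum_{i=0}^{n-1}u_i\beta^i\in\beta^n\mathbb Z[\beta]$ for all $n\in\mathbb N$. For an infinite word $\mathbf u=u_0u_1\cdots$ of integers, $P_{\mathbf u}(X)=\sum_{n\ge0}u_nX^n$. *)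

theory Defs
  imports "HOL-Computational_Algebra.Polynomial" Complex_Main
begin

definition beta_T :: "real \<Rightarrow> real \<Rightarrow> real" where
  "beta_T \<beta> x = \<beta> * x - of_int \<lfloor>\<beta> * x\<rfloor>"

definition beta_digit :: "real \<Rightarrow> real \<Rightarrow> nat \<Rightarrow> int" where
  "beta_digit \<beta> x j = \<lfloor>\<beta> * ((beta_T \<beta> ^^ (j - 1)) x)\<rfloor>"

definition purely_periodic_beta_exp :: "real \<Rightarrow> real \<Rightarrow> bool" where
  "purely_periodic_beta_exp \<beta> x \<longleftrightarrow>
     (\<exists>p\<ge>1. \<forall>k\<ge>1. beta_digit \<beta> x (k + p) = beta_digit \<beta> x k)"

text \<open>gamma(beta), with b = |N(beta)| passed explicitly.\<close>
definition gamma_beta :: "real \<Rightarrow> int \<Rightarrow> real" where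
  "gamma_beta \<beta> b = Inf ({r. \<exists>p q :: int. q > 0 \<and> r = of_int p / of_int q \<and>
        0 \<le> r \<and> r < 1 \<and> coprime q b \<and> \<not> purely_periodic_beta_exp \<beta> r} \<union> {1})"

definition Zbeta :: "real \<Rightarrow> real set" where
  "Zbeta \<beta> = {poly (map_poly of_int p) \<beta> | p :: int poly. True}"

text \<open>The beta-adic expansion h(x) with digits in {0,...,d-1}, d = |N(beta)|.\<close>
definition beta_adic :: "real \<Rightarrow> int \<Rightarrow> real \<Rightarrow> (nat \<Rightarrow> int)" where
  "beta_adic \<beta> d x = (THE u. (\<forall>n. 0 \<le> u n \<and> u n < d) \<and>
      (\<forall>n. x - (\<Sum>i<n. of_int (u i) * \<beta> ^ i) \<in> (\<lambda>y. \<beta> ^ n * y) ` Zbeta \<beta>))"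

definition P_word :: "(nat \<Rightarrow> int) \<Rightarrow> real \<Rightarrow> real" where
  "P_word u X = (\<Sum>n. of_int (u n) * X ^ n)"

end

(* Write c = -\<beta>', so \<beta> = a + c and \<beta> c = b, and let f(w) = P_{h(w)}(\<beta>').
   For gcd(q, b) = 1 the digits of a backward T-orbit in (1/q) Z[\<beta>] are determined modulo b by the
   \<beta>-adic expansion, and in the natural extension the fibre over x is an interval of conjugates y:
     f(x + \<beta>') - \<beta> \<le> y \<le> 1 + f(x - 1)       if x < b/\<beta>,
     1 + f(x - 1 + \<beta>') - \<beta> \<le> y \<le> 1 + f(x - 1)   if x \<ge> b/\<beta>.
   The forward map shrinks by c the distance of y to this interval, so points with a periodic
   expansion lie in it; conversely every lattice point of the domain has a preimage in the domain,
   and there are finitely many of them, so all are periodic.  For rational x = p/q we have y = x.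
   The upper bound gives 1 + inf_j f(j), because integers are b-adically dense in the rationals with
   denominator prime to b and rationals in a given residue class modulo b^k are dense in the reals.
   The arithmetic hypothesis makes the lower bound harmless whenever 1 + inf_j f(j) > 0. *)
theory Submission
  imports Defs "HOL-Number_Theory.Cong"
begin

section \<open>Digit sequences and periodic orbits of the \<beta>-transformation\<close>

text \<open>Equal digits make \<open>beta_T\<close> act on both points by the same affine map, so
  their difference is multiplied by \<beta> at every step, while two points of [0,1) always differ
  by less than 1.\<close>

lemma beta_T_eq_imp:
  fixes \<beta> x y :: real
  assumes beta_gt_1: "1 < \<beta>" and xy: "0 \<le> x" "x < 1" "0 \<le> y" "y < 1"
    and digits: "\<And>k. \<lfloor>\<beta> * (beta_T \<beta> ^^ k) x\<rfloor> = \<lfloor>\<beta> * (beta_T \<beta> ^^ k) y\<rfloor>"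
  shows "x = y"
proof (rule ccontr)
  assume "x \<noteq> y"
  have diff: "(beta_T \<beta> ^^ k) x - (beta_T \<beta> ^^ k) y = \<beta> ^ k * (x - y)" for k
  proof (induction k)
    case (Suc k)
    have "(beta_T \<beta> ^^ Suc k) x - (beta_T \<beta> ^^ Suc k) y = \<beta> * ((beta_T \<beta> ^^ k) x - (beta_T \<beta> ^^ k) y)"
      using digits[of k] by (simp add: beta_T_def algebra_simps)
    then show ?case by (simp add: Suc mult.assoc)
  qed simp
  have range: "0 \<le> (beta_T \<beta> ^^ k) z \<and> (beta_T \<beta> ^^ k) z < 1" if "0 \<le> z" "z < 1" for z k
  proof (cases k)
    case (Suc k')
    then show ?thesis using frac_ge_0 frac_lt_1 by (simp add: beta_T_def flip: frac_def)
  qed (use that in simp)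
  obtain k where k: "1 / \<bar>x - y\<bar> < \<beta> ^ k"
    using real_arch_pow[OF beta_gt_1] by blast
  then have 1: "1 < \<beta> ^ k * \<bar>x - y\<bar>" using \<open>x \<noteq> y\<close> by (simp add: field_simps)
  have "\<beta> ^ k * \<bar>x - y\<bar> = \<bar>(beta_T \<beta> ^^ k) x - (beta_T \<beta> ^^ k) y\<bar>"
    using beta_gt_1 by (simp add: diff abs_mult)
  also have "\<dots> < 1" using range[of x k] range[of y k] xy by linarith
  finally show False using 1 by simp
qed

lemma purely_periodic_iff:
  fixes \<beta> x :: real
  assumes "1 < \<beta>" "0 \<le> x" "x < 1"
  shows "purely_periodic_beta_exp \<beta> x \<longleftrightarrow> (\<exists>p\<ge>1. (beta_T \<beta> ^^ p) x = x)"
proof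
  assume "purely_periodic_beta_exp \<beta> x"
  then obtain p where p: "p \<ge> 1" "\<And>k. k \<ge> 1 \<Longrightarrow> beta_digit \<beta> x (k + p) = beta_digit \<beta> x k"
    unfolding purely_periodic_beta_exp_def by blast
  have eq: "\<lfloor>\<beta> * (beta_T \<beta> ^^ k) ((beta_T \<beta> ^^ p) x)\<rfloor> = \<lfloor>\<beta> * (beta_T \<beta> ^^ k) x\<rfloor>" for k
    using p(2)[of "Suc k"] by (simp add: beta_digit_def funpow_add)
  obtain p' where p': "p = Suc p'" using p(1) by (cases p) auto
  have "0 \<le> (beta_T \<beta> ^^ p) x" "(beta_T \<beta> ^^ p) x < 1"
    using frac_ge_0 frac_lt_1 by (simp_all add: p' beta_T_def flip: frac_def)
  then have "(beta_T \<beta> ^^ p) x = x" by (rule beta_T_eq_imp[OF assms(1)]) (use assms eq in auto)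
  then show "\<exists>p\<ge>1. (beta_T \<beta> ^^ p) x = x" using p(1) by blast
next
  assume "\<exists>p\<ge>1. (beta_T \<beta> ^^ p) x = x"
  then obtain p where p: "p \<ge> 1" "(beta_T \<beta> ^^ p) x = x" by blast
  have "beta_digit \<beta> x (k + p) = beta_digit \<beta> x k" if "k \<ge> 1" for k
  proof -
    have "k + p - 1 = (k - 1) + p" using that by simp
    then show ?thesis using p(2) by (simp add: beta_digit_def funpow_add)
  qed
  then show "purely_periodic_beta_exp \<beta> x"
    unfolding purely_periodic_beta_exp_def using p(1) by blast
qed

section \<open>Auxiliary facts on limits and on finite dynamics\<close>

lemma le_of_geometric:
  fixes c x y z :: real
  assumes "0 \<le> c" "c < 1" and le: "\<And>k. x \<le> y + c ^ k * z"
  shows "x \<le> y"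
proof -
  have "(\<lambda>k. y + c ^ k * z) \<longlonglongrightarrow> y + 0 * z"
    using assms by (intro tendsto_intros LIMSEQ_power_zero) auto
  then show ?thesis using LIMSEQ_le_const[of _ _ x] le by fastforce
qed

text \<open>Backward orbits under a right inverse of \<open>g\<close> stay in the finite set
  \<open>S\<close>, so the backward iterates \<open>i < j\<close> of \<open>x\<close> agree for some
  \<open>i\<close> and \<open>j\<close>; applying \<open>g\<close> to them \<open>j\<close> times
  gives the period \<open>j - i\<close>.\<close>

lemma finite_surj_periodic:
  assumes "finite S" "S \<subseteq> g ` S" "x \<in> S"
  shows "\<exists>p\<ge>1. (g ^^ p) x = x"
proof -
  define h where "h = inv_into S g"
  have h: "h y \<in> S" "g (h y) = y" if "y \<in> S" for y
  proof -
    have "y \<in> g ` S" using that assms(2) by (rule rev_subsetD)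
    then show "h y \<in> S" "g (h y) = y"
      unfolding h_def by (rule inv_into_into, rule f_inv_into_f)
  qed
  have hS: "(h ^^ i) x \<in> S" for i by (induction i) (use assms h in auto)
  have gh: "(g ^^ i) ((h ^^ i) x) = x" for i
  proof (induction i)
    case (Suc i)
    have "(g ^^ Suc i) ((h ^^ Suc i) x) = (g ^^ i) (g (h ((h ^^ i) x)))"
      by (simp add: funpow_swap1)
    then show ?case using h hS Suc by simp
  qed simp
  have "finite (range (\<lambda>i. (h ^^ i) x))"
    by (rule finite_subset[OF _ assms(1)]) (use hS in auto)
  then have "\<not> inj (\<lambda>i. (h ^^ i) x)"
    using finite_imageD infinite_UNIV_nat by blast
  then obtain i j where ij: "i < j" "(h ^^ i) x = (h ^^ j) x"
    unfolding inj_def by (metis nat_neq_iff)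
  have "x = (g ^^ (j - i + i)) ((h ^^ i) x)" using gh[of j] ij by simp
  also have "\<dots> = (g ^^ (j - i)) x" by (simp only: funpow_add o_apply gh)
  finally show ?thesis using ij by (intro exI[of _ "j - i"]) auto
qed

section \<open>The quadratic number \<beta> and its conjugate\<close>

locale quad =
  fixes a b :: int and \<beta> c :: real
  assumes b_le_a: "b \<le> a" and b_ge_1: "1 \<le> b"
    and c_pos: "0 < c" and c_less_1: "c < 1"
    and beta_eq: "\<beta> = of_int a + c" and beta_c: "\<beta> * c = of_int b"
begin

lemma c_square: "c * c = of_int b - of_int a * c"
  using beta_c by (simp add: beta_eq algebra_simps)

lemma beta_square: "\<beta> * \<beta> = of_int a * \<beta> + of_int b"
  using beta_c by (simp add: beta_eq algebra_simps)

lemma beta_gt_a: "of_int a < \<beta>"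
  using c_pos by (simp add: beta_eq)

lemma a_ge_1: "1 \<le> a"
  using b_le_a b_ge_1 by simp

lemma beta_gt_1: "1 < \<beta>"
  using beta_gt_a a_ge_1 by linarith

text \<open>The largest value of a series in powers of \<open>- c\<close> with digits from 0 to
  \<open>b - 1\<close>: digit \<open>b - 1\<close> at even exponents and 0 at odd ones.\<close>

definition B :: real where "B = (of_int b - 1) / (1 - c * c)"

lemma one_minus_cc: "0 < 1 - c * c"
  using mult_strict_mono[of c 1 c 1] c_pos c_less_1 by simp

lemma B_eq: "B = of_int b - 1 + c * c * B"
  using one_minus_cc by (simp add: B_def field_simps)

lemma B_nonneg: "0 \<le> B"
  using one_minus_cc b_ge_1 by (simp add: B_def)

lemma B_le_iff: "B \<le> x \<longleftrightarrow> of_int b - 1 \<le> x * (1 - c * c)"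
  using one_minus_cc by (simp add: B_def pos_divide_le_eq)

text \<open>A rational root of a monic integer polynomial is an integer, but \<beta> lies strictly
  between \<open>a\<close> and \<open>a + 1\<close>.\<close>

lemma beta_lin_indep:
  assumes "of_int m + of_int n * \<beta> = (0::real)"
  shows "m = 0 \<and> n = 0"
proof (cases "n = 0")
  case False
  define r where "r = - real_of_int m / real_of_int n"
  have r: "\<beta> = r" using assms False by (simp add: r_def field_simps)
  have sq: "m * m + a * m * n - b * n * n = 0"
  proof -
    have "r * r = of_int a * r + of_int b" using beta_square r by simp
    then have "real_of_int m * m = - of_int a * m * n + of_int b * n * n"
      using False by (simp add: r_def field_simps)
    then have "real_of_int (m * m) = real_of_int (- (a * m * n) + b * n * n)" by simp
    then show ?thesis by (simp only: of_int_eq_iff) 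
  qed
  define g where "g = gcd m n"
  have "g \<noteq> 0" using False by (simp add: g_def)
  obtain m' n' where mn: "m = g * m'" "n = g * n'" "coprime m' n'"
    using gcd_coprime_exists[of m n] \<open>g \<noteq> 0\<close> unfolding g_def by (metis mult.commute)
  have "g * g * (m' * m' + a * m' * n' - b * n' * n') = 0"
    using sq by (simp add: mn algebra_simps)
  then have "m' * m' + a * m' * n' - b * n' * n' = 0"
    using \<open>g \<noteq> 0\<close> by (simp only: mult_eq_0_iff) simp
  then have "m' * m' = n' * (b * n' - a * m')" by (simp add: algebra_simps)
  then have "n' dvd m' * m'" by simp
  then have "n' dvd m'" using mn(3) by (metis coprime_commute coprime_dvd_mult_left_iff)
  then have "is_unit n'" using mn(3) by (meson coprime_absorb_right coprime_common_divisor dvd_refl)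
  then have "n' = 1 \<or> n' = -1" by (simp add: abs_eq_iff')
  then have "n dvd m" using mn by auto
  then obtain k where "m = n * k" by blast
  then have "\<beta> = of_int (-k)" using r False by (simp add: r_def)
  then have "a < -k" "-k < a + 1" using beta_eq c_pos c_less_1 by linarith+
  then show ?thesis by simp
qed (use assms in simp)

end

section \<open>\<beta>-adic digits on the lattice (1/q) Z[\<beta>]\<close>

locale quad_lattice = quad +
  fixes q qi :: int
  assumes q_pos: "0 < q" and q_inv: "b dvd q * qi - 1"
begin

lemma beta_q_c: "\<beta> * (q * c) = of_int q * of_int b"
proof -
  have "\<beta> * (q * c) = q * (\<beta> * c)" by (simp add: algebra_simps)
  then show ?thesis by (simp add: beta_c)
qed

text \<open>Modulo \<beta> the ring Z[\<beta>] becomes Z/b and \<open>(m + n \<beta>) / q\<close>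
  becomes \<open>m / q\<close>, so the first digit depends on \<open>m\<close> alone. The quotient
  \<open>qt m\<close> passes to the next pair through b / \<beta> = \<beta> - a.\<close>

definition dg :: "int \<Rightarrow> int" where "dg m = (m * qi) mod b"

definition qt :: "int \<Rightarrow> int" where "qt m = (m - q * dg m) div b"

lemma dg_bounds: "0 \<le> dg m" "dg m < b"
  using b_ge_1 by (auto simp: dg_def)

lemma dg_qt_unique:
  assumes "m = q * r + b * k" "0 \<le> r" "r < b"
  shows "dg m = r" "qt m = k"
proof -
  obtain t where t: "q * qi = 1 + b * t" using q_inv by (metis diff_add_cancel dvdE add.commute)
  have "m * qi = (q * qi) * r + b * (k * qi)" using assms by (simp add: algebra_simps)
  also have "\<dots> = r + b * (t * r + k * qi)" by (simp add: t algebra_simps)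
  finally show 1: "dg m = r" using assms by (simp add: dg_def)
  have "m - q * dg m = b * k" by (subst 1) (simp add: assms(1))
  then show "qt m = k" using b_ge_1 by (simp add: qt_def)
qed

lemma dg_qt: "m = q * dg m + b * qt m"
proof -
  obtain t where t: "q * qi = 1 + b * t" using q_inv by (metis diff_add_cancel dvdE add.commute)
  have "dg m = m * qi - b * ((m * qi) div b)"
    by (simp add: dg_def minus_mult_div_eq_mod)
  then have "m - q * dg m = m - q * (m * qi - b * ((m * qi) div b))" by (simp only:)
  also have "\<dots> = m - m * (q * qi) + b * (q * ((m * qi) div b))"
    by (simp add: algebra_simps)
  also have "\<dots> = b * (q * ((m * qi) div b) - m * t)" by (simp add: t algebra_simps)
  finally have "b dvd m - q * dg m" by simp
  then show ?thesis by (simp add: qt_def)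
qed

text \<open>The pair \<open>(m, n)\<close> stands for \<open>w = (m + n \<beta>) / q\<close>; the recursive call is at
  \<open>(w - dg m) / \<beta>\<close>.\<close>
primrec digit :: "nat \<Rightarrow> int \<Rightarrow> int \<Rightarrow> int" where
  "digit 0 m n = dg m"
| "digit (Suc i) m n = digit i (n - a * qt m) (qt m)"

primrec ftrunc :: "nat \<Rightarrow> int \<Rightarrow> int \<Rightarrow> real" where
  "ftrunc 0 m n = 0"
| "ftrunc (Suc i) m n = of_int (dg m) - c * ftrunc i (n - a * qt m) (qt m)"

definition f :: "int \<Rightarrow> int \<Rightarrow> real" where
  "f m n = (\<Sum>i. of_int (digit i m n) * (- c) ^ i)"

lemma digit_bounds: "0 \<le> digit i m n" "digit i m n < b"
  by (induction i arbitrary: m n) (auto simp: dg_bounds)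

lemma ftrunc_sum: "ftrunc k m n = (\<Sum>i<k. of_int (digit i m n) * (- c) ^ i)"
proof (induction k arbitrary: m n)
  case (Suc k)
  show ?case
    by (simp add: Suc.IH sum.lessThan_Suc_shift sum_distrib_left sum_negf algebra_simps
        del: sum.lessThan_Suc)
qed simp

lemma summable_digits: "summable (\<lambda>i. of_int (digit i m n) * (- c) ^ i)"
proof (rule summable_comparison_test')
  show "summable (\<lambda>i. of_int b * c ^ i)"
    using c_pos c_less_1 by (intro summable_mult summable_geometric) simp
  show "norm (of_int (digit i m n) * (- c) ^ i) \<le> of_int b * c ^ i" for i
    using digit_bounds[of i m n] c_pos by (simp add: abs_mult power_abs mult_right_mono)
qed

lemma ftrunc_tendsto: "(\<lambda>k. ftrunc k m n) \<longlonglongrightarrow> f m n"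
  unfolding ftrunc_sum f_def by (rule summable_LIMSEQ) (rule summable_digits)

lemma f_rec: "f m n = of_int (dg m) - c * f (n - a * qt m) (qt m)"
proof (rule LIMSEQ_unique)
  show "(\<lambda>k. ftrunc (Suc k) m n) \<longlonglongrightarrow> f m n"
    using ftrunc_tendsto by (rule LIMSEQ_Suc)
  show "(\<lambda>k. ftrunc (Suc k) m n) \<longlonglongrightarrow> of_int (dg m) - c * f (n - a * qt m) (qt m)"
    unfolding ftrunc.simps by (intro tendsto_intros ftrunc_tendsto)
qed

lemma f_split:
  assumes "0 \<le> r" "r < b"
  shows "f (q * r + b * k) n = of_int r - c * f (n - a * k) k"
  using dg_qt_unique[OF refl assms, of k] by (subst f_rec) simp

text \<open>Multiplication by \<open>\<beta>\<close> maps \<open>(m, n)\<close> to \<open>(b n, m + a n)\<close>.\<close>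
lemma f_beta_mult:
  assumes "0 \<le> r" "r < b"
  shows "f (q * r + b * n) (m + a * n) = of_int r - c * f m n"
  using f_split[OF assms, of n "m + a * n"] by simp

text \<open>The two inequalities feed each other through the carries. They are preserved by the recursion,
  and at \<open>k = 0\<close> they are trivial.\<close>
lemma ftrunc_incr:
  "ftrunc k (m + q) n \<le> ftrunc k m n + 1 \<and> ftrunc k (m + a * q) (n - q) \<le> ftrunc k m n + \<beta>"
proof (induction k arbitrary: m n)
  case 0
  then show ?case using beta_gt_1 by simp
next
  case (Suc k)
  define r where "r = dg m"
  define t where "t = qt m"
  have m: "m = q * r + b * t" unfolding r_def t_def by (rule dg_qt)
  have r: "0 \<le> r" "r < b" by (auto simp: r_def dg_bounds)
  have IH1: "ftrunc k (m + q) n \<le> ftrunc k m n + 1" for m n using Suc by blast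
  have IH2: "ftrunc k (m + a * q) (n - q) \<le> ftrunc k m n + \<beta>" for m n using Suc by blast
  have IH2': "ftrunc k m n \<le> ftrunc k (m - int l * (a * q)) (n + int l * q) + of_nat l * \<beta>" for l m n
  proof (induction l)
    case (Suc l)
    have "ftrunc k (m - int l * (a * q)) (n + int l * q) \<le>
      ftrunc k (m - int (Suc l) * (a * q)) (n + int (Suc l) * q) + \<beta>"
      using IH2[of "m - int (Suc l) * (a * q)" "n + int (Suc l) * q"]
      by (simp add: algebra_simps)
    then show ?case using Suc by (simp add: algebra_simps)
  qed simp
  have fm: "ftrunc (Suc k) m n = of_int r - c * ftrunc k (n - a * t) t"
    by (simp add: r_def t_def)
  \<comment> \<open>Only the top digit carries. As b = \<beta> (\<beta> - a), the carry adds \<beta>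
    - a to the remaining number; the second inequality bounds the effect by \<beta>, and the factor
    \<open>c\<close> turns this into the \<open>b\<close> lost in the digit.\<close>
  have "ftrunc (Suc k) (m + q) n \<le> ftrunc (Suc k) m n + 1"
  proof (cases "r = b - 1")
    case False
    have "dg (m + q) = r + 1" "qt (m + q) = t"
      using dg_qt_unique[of "m + q" "r + 1" t] m r False by (auto simp: algebra_simps)
    then show ?thesis unfolding fm by simp
  next
    case True
    have "dg (m + q) = 0" "qt (m + q) = t + q"
      using dg_qt_unique[of "m + q" 0 "t + q"] m r True by (auto simp: algebra_simps)
    then have eq: "ftrunc (Suc k) (m + q) n = - c * ftrunc k (n - a * (t + q)) (t + q)"
      by simp
    have "ftrunc k (n - a * t) t \<le> ftrunc k (n - a * (t + q)) (t + q) + \<beta>"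
      using IH2'[of "n - a * t" t 1] by (simp add: algebra_simps)
    then have "c * ftrunc k (n - a * t) t \<le> c * (ftrunc k (n - a * (t + q)) (t + q) + \<beta>)"
      using c_pos by simp
    then show ?thesis using beta_c True by (simp add: eq fm algebra_simps del: ftrunc.simps)
  qed
  moreover have "ftrunc (Suc k) (m + a * q) (n - q) \<le> ftrunc (Suc k) m n + \<beta>"
  proof -
    \<comment> \<open>Here w changes by a - \<beta>: the first digit grows by \<open>a\<close> with
      \<open>l\<close> carries, and -\<beta> lowers the remaining number by 1. The total cost is a +
      c = \<beta>.\<close>
    define r' where "r' = (r + a) mod b"
    define l where "l = (r + a) div b"
    have rl: "r + a = r' + b * l" by (simp add: r'_def l_def)
    have r': "0 \<le> r'" "r' < b" "0 \<le> l"
      using b_ge_1 r a_ge_1 by (auto simp: r'_def l_def pos_imp_zdiv_nonneg_iff)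
    have "m + a * q = q * (r + a) + b * t" by (simp add: m algebra_simps)
    also have "\<dots> = q * (r' + b * l) + b * t" by (simp only: rl)
    also have "\<dots> = q * r' + b * (t + q * l)" by (simp add: algebra_simps)
    finally have "dg (m + a * q) = r'" "qt (m + a * q) = t + q * l"
      using dg_qt_unique[of "m + a * q" r' "t + q * l"] r' by auto
    then have eq: "ftrunc (Suc k) (m + a * q) (n - q) =
        of_int r' - c * ftrunc k (n - q - a * (t + q * l)) (t + q * l)"
      by simp
    have "ftrunc k (n - a * t) t \<le> ftrunc k (n - a * t - q) t + 1"
      using IH1[of "n - a * t - q" t] by simp
    also have "ftrunc k (n - a * t - q) t \<le>
        ftrunc k (n - q - a * (t + q * l)) (t + q * l) + of_int l * \<beta>"
      using IH2'[of "n - a * t - q" t "nat l"] r' by (simp add: algebra_simps)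
    finally have "c * ftrunc k (n - a * t) t \<le>
        c * (ftrunc k (n - q - a * (t + q * l)) (t + q * l) + of_int l * \<beta> + 1)"
      using c_pos by simp
    also have "\<dots> = c * ftrunc k (n - q - a * (t + q * l)) (t + q * l) + of_int (b * l) + c"
      using beta_c by (simp add: algebra_simps)
    also have "of_int (b * l) = (of_int (r + a) - of_int r' :: real)" by (simp only: rl)
    finally show ?thesis by (simp add: eq fm beta_eq del: ftrunc.simps)
  qed
  ultimately show ?case by blast
qed

lemma f_add_1: "f (m + q) n \<le> f m n + 1"
  by (rule LIMSEQ_le[OF ftrunc_tendsto tendsto_add[OF ftrunc_tendsto tendsto_const]])
    (use ftrunc_incr in blast)

lemma f_add_nat: "f (m + q * int k) n \<le> f m n + of_nat k"
proof (induction k)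
  case (Suc k)
  then show ?case using f_add_1[of "m + q * int k" n] by (simp add: algebra_simps)
qed simp

lemma f_add_int: "0 \<le> k \<Longrightarrow> f (m + q * k) n \<le> f m n + of_int k"
  using f_add_nat[of m "nat k" n] by simp

lemma ftrunc_bounds: "- c * B \<le> ftrunc k m n \<and> ftrunc k m n \<le> B"
proof (induction k arbitrary: m n)
  case 0
  then show ?case using B_nonneg c_pos by simp
next
  case (Suc k)
  let ?g = "ftrunc k (n - a * qt m) (qt m)"
  have "c * (- c * B) \<le> c * ?g" "c * ?g \<le> c * B"
    using Suc c_pos by (intro mult_left_mono; simp)+
  moreover have "0 \<le> real_of_int (dg m)" "real_of_int (dg m) \<le> of_int b - 1"
    using dg_bounds[of m] by auto
  ultimately show ?case using B_eq by simp
qed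

lemma f_le_B: "f m n \<le> B"
  by (rule LIMSEQ_le_const2[OF ftrunc_tendsto]) (use ftrunc_bounds in blast)

lemma f_ge: "- c * B \<le> f m n"
  by (rule LIMSEQ_le_const[OF ftrunc_tendsto]) (use ftrunc_bounds in blast)

lemma f_diff_bound: "\<bar>f m n - f m' n'\<bar> \<le> 2 * B"
proof -
  have "c * B \<le> B" using B_nonneg c_less_1 c_pos mult_right_mono[of c 1 B] by simp
  then show ?thesis
    using f_le_B[of m n] f_ge[of m n] f_le_B[of m' n'] f_ge[of m' n'] by simp
qed

text \<open>Since b = \<beta> (\<beta> - a), adding a multiple of \<open>b ^ k\<close> leaves the
  first \<open>k\<close> digits unchanged, and the difference of the tails carries the factor
  \<open>c ^ k\<close>.\<close>

lemma f_approx: "\<bar>f (m + b ^ k * s) (n + b ^ k * t) - f m n\<bar> \<le> c ^ k * (2 * B)"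
proof (induction k arbitrary: m n s t)
  case 0
  then show ?case using f_diff_bound by simp
next
  case (Suc k)
  define r where "r = dg m"
  define l where "l = qt m"
  have m: "m = q * r + b * l" unfolding r_def l_def by (rule dg_qt)
  have r: "0 \<le> r" "r < b" by (auto simp: r_def dg_bounds)
  have 1: "f m n = of_int r - c * f (n - a * l) l" by (simp add: m f_split[OF r])
  have "m + b ^ Suc k * s = q * r + b * (l + b ^ k * s)" by (simp add: m algebra_simps)
  then have 2: "f (m + b ^ Suc k * s) (n + b ^ Suc k * t) =
     of_int r - c * f ((n - a * l) + b ^ k * (b * t - a * s)) (l + b ^ k * s)"
    by (simp only: f_split[OF r]) (simp add: algebra_simps)
  have "\<bar>f (m + b ^ Suc k * s) (n + b ^ Suc k * t) - f m n\<bar> =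
      c * \<bar>f ((n - a * l) + b ^ k * (b * t - a * s)) (l + b ^ k * s) - f (n - a * l) l\<bar>"
    unfolding 1 2 using c_pos by (simp add: abs_if algebra_simps)
  also have "\<dots> \<le> c * (c ^ k * (2 * B))"
    using Suc.IH c_pos by (intro mult_left_mono) auto
  finally show ?case by simp
qed

section \<open>Fibre bounds and their behaviour under one step\<close>

text \<open>Both embeddings are scaled by \<open>q\<close>: the point is x =
  \<open>val m n / q\<close> with conjugate y = \<open>conj_val m n / q\<close>, whereas the bounds
  \<open>upper\<close> and \<open>lower\<close> are not scaled.\<close>

definition val :: "int \<Rightarrow> int \<Rightarrow> real" where "val m n = of_int m + of_int n * \<beta>"

definition conj_val :: "int \<Rightarrow> int \<Rightarrow> real" where "conj_val m n = of_int m - of_int n * c"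

definition upper :: "int \<Rightarrow> int \<Rightarrow> real" where "upper m n = 1 + f (m - q) n"

definition lower0 :: "int \<Rightarrow> int \<Rightarrow> real" where
  "lower0 m n = f (m + a * q) (n - q) - \<beta>"

definition lower1 :: "int \<Rightarrow> int \<Rightarrow> real" where
  "lower1 m n = 1 + f (m - q + a * q) (n - q) - \<beta>"

text \<open>The condition \<open>val m n < q * c\<close> says \<open>x < b / \<beta>\<close>, that is, the digit \<open>a\<close> may precede \<open>x\<close>.\<close>
definition lower :: "int \<Rightarrow> int \<Rightarrow> real" where
  "lower m n = (if val m n < q * c then lower0 m n else lower1 m n)"

definition good :: "int \<Rightarrow> int \<Rightarrow> bool" where
  "good m n \<longleftrightarrow> 0 \<le> val m n \<and> val m n < q \<and>
     q * lower m n \<le> conj_val m n \<and> conj_val m n \<le> q * upper m n"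

lemma lower0_le_lower1: "lower0 m n \<le> lower1 m n"
  using f_add_1[of "m - q + a * q" "n - q"] by (simp add: lower0_def lower1_def)

lemma val_step: "val (b * n - q * d) (m + a * n) = \<beta> * val m n - q * d"
proof -
  have "\<beta> * val m n = m * \<beta> + n * (\<beta> * \<beta>)" by (simp add: val_def algebra_simps)
  then show ?thesis by (simp add: beta_square) (simp add: val_def algebra_simps)
qed

lemma conj_step: "conj_val (b * n - q * d) (m + a * n) = - c * conj_val m n - q * d"
proof -
  have "- c * conj_val m n = - c * m + n * (c * c)" by (simp add: conj_val_def algebra_simps)
  then show ?thesis by (simp add: c_square) (simp add: conj_val_def algebra_simps)
qed

text \<open>The branch x -> \<beta> x - d has the conjugate y -> - c y - d, which reverses order and
  so exchanges the ends of a fibre. By \<beta> \<beta>' = - b, the number \<beta> x - d - 1 equals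
  (b - 1 - d) + \<beta> (x + \<beta>'), whose first digit is \<open>b - 1 - d\<close>.\<close>

lemma upper_step_eq:
  assumes "0 \<le> d" "d < b"
  shows "upper (b * n - q * d) (m + a * n) = - c * lower0 m n - d"
proof -
  have "f (b * n - q * d - q) (m + a * n) = f (q * (b - 1 - d) + b * (n - q)) ((m + a * q) + a * (n - q))"
    by (simp add: algebra_simps)
  also have "\<dots> = of_int (b - 1 - d) - c * f (m + a * q) (n - q)"
    using assms by (intro f_beta_mult) auto
  finally show ?thesis using beta_c by (simp add: upper_def lower0_def algebra_simps)
qed

lemma lower0_step_eq:
  assumes "0 \<le> a - d" "a - d < b"
  shows "lower0 (b * n - q * d) (m + a * n) = - c * upper m n - d"
proof -
  have "f (b * n - q * d + a * q) (m + a * n - q) = f (q * (a - d) + b * n) ((m - q) + a * n)"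
    by (simp add: algebra_simps)
  also have "\<dots> = of_int (a - d) - c * f (m - q) n"
    using assms by (intro f_beta_mult) auto
  finally show ?thesis unfolding upper_def lower0_def using beta_eq by (simp add: algebra_simps)
qed

lemma lower1_step_eq:
  assumes "0 \<le> a - 1 - d" "a - 1 - d < b"
  shows "lower1 (b * n - q * d) (m + a * n) = - c * upper m n - d"
proof -
  have "f (b * n - q * d - q + a * q) (m + a * n - q) = f (q * (a - 1 - d) + b * n) ((m - q) + a * n)"
    by (simp add: algebra_simps)
  also have "\<dots> = of_int (a - 1 - d) - c * f (m - q) n"
    using assms by (intro f_beta_mult) auto
  finally show ?thesis unfolding upper_def lower1_def using beta_eq by (simp add: algebra_simps)
qed

lemma lower1_step_le:
  assumes "d \<le> a - 1"
  shows "lower1 (b * n - q * d) (m + a * n) \<le> - c * upper m n - d"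
proof -
  have "f (b * n - q * d - q + a * q) (m + a * n - q) = f (q * 0 + b * n + q * (a - 1 - d)) ((m - q) + a * n)"
    by (simp add: algebra_simps)
  also have "\<dots> \<le> f (q * 0 + b * n) ((m - q) + a * n) + of_int (a - 1 - d)"
    using assms by (intro f_add_int) auto
  also have "f (q * 0 + b * n) ((m - q) + a * n) = of_int 0 - c * f (m - q) n"
    using b_ge_1 by (intro f_beta_mult) auto
  finally show ?thesis unfolding upper_def lower1_def using beta_eq by (simp add: algebra_simps)
qed

lemma upper_step_ge:
  assumes "b \<le> d"
  shows "- c * lower1 m n - d \<le> upper (b * n - q * d) (m + a * n)"
proof -
  have "f (q * 0 + b * (n - q)) ((m + a * q) + a * (n - q)) = of_int 0 - c * f (m + a * q) (n - q)"
    using b_ge_1 by (intro f_beta_mult) auto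
  then have 2: "f (b * (n - q)) (m + a * n) = - c * f (m + a * q) (n - q)"
    by (simp add: algebra_simps)
  have "f (m + a * q) (n - q) \<le> f (m - q + a * q) (n - q) + 1"
    using f_add_1[of "m - q + a * q" "n - q"] by simp
  then have 3: "c * f (m + a * q) (n - q) \<le> c * (f (m - q + a * q) (n - q) + 1)"
    using c_pos by simp
  have "f (b * (n - q)) (m + a * n) =
      f (b * n - q * d - q + q * (d + 1 - b)) (m + a * n)"
    by (simp add: algebra_simps)
  also have "\<dots> \<le> f (b * n - q * d - q) (m + a * n) + of_int (d + 1 - b)"
    using assms by (intro f_add_int) auto
  finally show ?thesis using 2 3 beta_c
    by (simp add: upper_def lower1_def algebra_simps)
qed

text \<open>Together the inequalities say that y -> - c y - d maps the fibre over x into the fibre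
  over the image of x.\<close>

lemma step_bounds:
  assumes "0 \<le> val m n" "val m n < q"
    and "q * d \<le> \<beta> * val m n" "\<beta> * val m n < q * d + q"
  shows "- c * lower m n - d \<le> upper (b * n - q * d) (m + a * n)"
    and "lower (b * n - q * d) (m + a * n) \<le> - c * upper m n - d"
proof -
  have q: "0 < real_of_int q" using q_pos by simp
  have beta_pos: "0 < \<beta>" using beta_gt_1 by simp
  have d0: "0 \<le> d"
  proof -
    have "0 \<le> \<beta> * val m n" using assms(1) beta_pos by simp
    then have "0 < q * (real_of_int d + 1)" using assms(4) by (simp add: algebra_simps)
    then have "0 < real_of_int d + 1" using q zero_less_mult_pos by blast
    then show ?thesis by linarith
  qed
  have da: "d \<le> a"
  proof -
    have "\<beta> * val m n < \<beta> * q" using assms(2) beta_pos by simp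
    then have "q * real_of_int d < q * \<beta>" using assms(3) by (simp add: mult.commute)
    then have "real_of_int d < \<beta>" using q by simp
    then show ?thesis using beta_eq c_less_1 by linarith
  qed
  show "- c * lower m n - d \<le> upper (b * n - q * d) (m + a * n)"
  proof (cases "val m n < q * c")
    case True
    then have "\<beta> * val m n < \<beta> * (q * c)" using beta_pos by simp
    also have "\<dots> = of_int q * of_int b" by (rule beta_q_c)
    finally have "q * real_of_int d < q * real_of_int b" using assms(3) by simp
    then have "d < b" using q by simp
    then show ?thesis using upper_step_eq[OF d0, of n m] True by (simp add: lower_def)
  next
    case False
    then have "\<beta> * (q * c) \<le> \<beta> * val m n" using beta_pos by simp
    then have "of_int q * of_int b \<le> \<beta> * val m n" by (simp only: beta_q_c)
    then have "q * real_of_int b < q * (real_of_int d + 1)"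
      using assms(4) unfolding distrib_left of_int_mult of_int_add by linarith
    then have "real_of_int b < real_of_int d + 1" using q by simp
    then have "b \<le> d" by linarith
    then show ?thesis using upper_step_ge[of d m n] False by (simp add: lower_def)
  qed
  \<comment> \<open>After the digit \<open>a\<close> the image lies below \<beta> - a = c, where
    \<open>lower\<close> is \<open>lower0\<close>; for smaller digits the estimate for
    \<open>lower1\<close> covers both forms.\<close>
  show "lower (b * n - q * d) (m + a * n) \<le> - c * upper m n - d"
  proof (cases "d = a")
    case True
    have "\<beta> * val m n < \<beta> * q" using assms(2) beta_pos by simp
    then have "val (b * n - q * d) (m + a * n) < q * c"
      unfolding val_step by (simp add: True beta_eq algebra_simps)
    then show ?thesis using lower0_step_eq[of d n m] True b_ge_1 by (simp add: lower_def)
  next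
    case False
    then have "lower1 (b * n - q * d) (m + a * n) \<le> - c * upper m n - d"
      using da by (intro lower1_step_le) simp
    then show ?thesis using lower0_le_lower1[of "b * n - q * d" "m + a * n"]
      by (simp add: lower_def)
  qed
qed

section \<open>Periodic lattice points have their conjugates in the fibre\<close>

definition step :: "int \<times> int \<Rightarrow> int \<times> int" where
  "step = (\<lambda>(m, n). (b * n - q * \<lfloor>\<beta> * (val m n / q)\<rfloor>, m + a * n))"

lemma step_floor:
  fixes m n defines "d \<equiv> \<lfloor>\<beta> * (val m n / q)\<rfloor>"
  shows "q * d \<le> \<beta> * val m n" "\<beta> * val m n < q * d + q"
proof -
  have q: "0 < real_of_int q" using q_pos by simp
  have "d \<le> \<beta> * (val m n / q)" "\<beta> * (val m n / q) < d + 1"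
    unfolding d_def by linarith+
  then show "q * d \<le> \<beta> * val m n" "\<beta> * val m n < q * d + q"
    using q by (simp_all add: field_simps)
qed

lemma val_step_beta_T: "case_prod val (step p) / q = beta_T \<beta> (case_prod val p / q)"
  using q_pos by (cases p) (simp add: step_def val_step beta_T_def diff_divide_distrib)

lemma val_funpow_step: "case_prod val ((step ^^ k) p) / q = (beta_T \<beta> ^^ k) (case_prod val p / q)"
  by (induction k) (simp_all add: val_step_beta_T)

text \<open>The number \<open>e\<close> bounds how far y lies outside the fibre. The conjugate map
  contracts by \<open>c\<close> and sends fibre into fibre, so the bound shrinks by
  \<open>c\<close>.\<close>

lemma excess_step:
  assumes "0 \<le> val m n" "val m n < q" "0 \<le> e"
    and "q * (lower m n - e) \<le> conj_val m n" "conj_val m n \<le> q * (upper m n + e)"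
    and "step (m, n) = (m', n')"
  shows "0 \<le> val m' n'" "val m' n' < q"
    "q * (lower m' n' - c * e) \<le> conj_val m' n'" "conj_val m' n' \<le> q * (upper m' n' + c * e)"
proof -
  define d where "d = \<lfloor>\<beta> * (val m n / q)\<rfloor>"
  have d: "q * d \<le> \<beta> * val m n" "\<beta> * val m n < q * d + q"
    unfolding d_def by (rule step_floor)+
  have q: "0 < real_of_int q" using q_pos by simp
  have mn': "m' = b * n - q * d" "n' = m + a * n" using assms(6) by (auto simp: step_def d_def)
  show "0 \<le> val m' n'" "val m' n' < q" using d by (auto simp: mn' val_step)
  note sb = step_bounds[OF assms(1,2) d, folded mn']
  have "c * (q * (lower m n - e)) \<le> c * conj_val m n" "c * conj_val m n \<le> c * (q * (upper m n + e))"
    using assms(4,5) c_pos by auto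
  moreover have "q * (- c * lower m n - d) \<le> q * upper m' n'" "q * lower m' n' \<le> q * (- c * upper m n - d)"
    using sb q by auto
  moreover have "conj_val m' n' = - c * conj_val m n - q * d"
    unfolding mn' by (rule conj_step)
  ultimately show "q * (lower m' n' - c * e) \<le> conj_val m' n'" "conj_val m' n' \<le> q * (upper m' n' + c * e)"
    by (simp_all add: algebra_simps)
qed

lemma excess_funpow:
  assumes "0 \<le> val m n" "val m n < q" "0 \<le> e"
    and "q * (lower m n - e) \<le> conj_val m n" "conj_val m n \<le> q * (upper m n + e)"
    and "(step ^^ k) (m, n) = (m', n')"
  shows "0 \<le> val m' n' \<and> val m' n' < q \<and>
    q * (lower m' n' - c ^ k * e) \<le> conj_val m' n' \<and> conj_val m' n' \<le> q * (upper m' n' + c ^ k * e)"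
  using assms(6)
proof (induction k arbitrary: m' n')
  case 0
  then show ?case using assms by simp
next
  case (Suc k)
  obtain m1 n1 where 1: "(step ^^ k) (m, n) = (m1, n1)" by fastforce
  have 2: "step (m1, n1) = (m', n')" using Suc.prems 1 by simp
  have "0 \<le> c ^ k * e" using c_pos assms(3) by simp
  then show ?case using excess_step[OF _ _ _ _ _ 2, of "c ^ k * e"] Suc.IH[OF 1] by (simp add: mult.assoc)
qed

text \<open>As \<beta> is irrational, a return of x is a return of the lattice point, with the same
  fibre and the same y. The distance from y to this fibre is therefore at most
  \<open>c ^ (p * k) * e\<close> for all \<open>k\<close>, hence 0.\<close>

lemma periodic_imp_upper:
  assumes "0 \<le> val m n" "val m n < q" "purely_periodic_beta_exp \<beta> (val m n / q)"
  shows "conj_val m n \<le> q * upper m n"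
proof -
  have q: "0 < real_of_int q" using q_pos by simp
  obtain p where p: "p \<ge> 1" "(beta_T \<beta> ^^ p) (val m n / q) = val m n / q"
    using assms q purely_periodic_iff[OF beta_gt_1, of "val m n / q"] by auto
  obtain m' n' where 1: "(step ^^ p) (m, n) = (m', n')" by fastforce
  have "val m' n' / q = val m n / q" using val_funpow_step[of p "(m, n)"] p(2) 1 by simp
  then have "val m' n' = val m n" using q by simp
  then have "m' = m" "n' = n"
    using beta_lin_indep[of "m' - m" "n' - n"] by (auto simp: val_def algebra_simps)
  then have sp: "(step ^^ p) (m, n) = (m, n)" using 1 by simp
  have spk: "(step ^^ (p * k)) (m, n) = (m, n)" for k
    by (induction k) (simp_all add: funpow_add sp)
  define e where "e = \<bar>conj_val m n / q - upper m n\<bar> + \<bar>conj_val m n / q - lower m n\<bar>"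
  have "lower m n - e \<le> conj_val m n / q" "conj_val m n / q \<le> upper m n + e"
    unfolding e_def by linarith+
  then have e: "q * (lower m n - e) \<le> conj_val m n" "conj_val m n \<le> q * (upper m n + e)" "0 \<le> e"
    using q by (auto simp: pos_divide_le_eq pos_le_divide_eq mult.commute e_def)
  have "conj_val m n \<le> q * (upper m n + c ^ (p * k) * e)" for k
    using excess_funpow[OF assms(1,2) e(3,1,2) spk[of k]] by blast
  then have le: "conj_val m n \<le> q * (upper m n + (c ^ p) ^ k * e)" for k
    by (simp add: power_mult)
  have "c ^ p < 1" using c_pos c_less_1 p(1) by (simp add: power_less_one_iff)
  have "(\<lambda>k. q * (upper m n + (c ^ p) ^ k * e)) \<longlonglongrightarrow> q * (upper m n + 0 * e)"
    by (intro tendsto_intros) (use c_pos \<open>c ^ p < 1\<close> in simp)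
  then show ?thesis using LIMSEQ_le_const[of _ _ "conj_val m n"] le by fastforce
qed

section \<open>Lattice points of the domain are periodic\<close>

text \<open>A predecessor with digit \<open>d\<close> exists only if -m is congruent to q d modulo
  \<open>b\<close>, so the candidate digits are \<open>r\<close>, \<open>r + b\<close>,
  \<open>r + 2 b\<close> and so on; one is chosen whose fibre has an image containing y.\<close>

lemma good_pred:
  assumes "good m n"
  obtains m' n' where "good m' n'" "step (m', n') = (m, n)"
proof -
  have q: "0 < real_of_int q" using q_pos by simp
  have beta_pos: "0 < \<beta>" using beta_gt_1 by simp
  define r where "r = dg (- m)"
  define t where "t = qt (- m)"
  have rt: "- m = q * r + b * t" unfolding r_def t_def by (rule dg_qt)
  have r: "0 \<le> r" "r < b" by (auto simp: r_def dg_bounds)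
  define n' where "n' = (\<lambda>k. - t + q * int k)"
  define m' where "m' = (\<lambda>k. n - a * n' k)"
  define d where "d = (\<lambda>k. r + b * int k)"
  have m: "m = b * n' k - q * d k" and n: "n = m' k + a * n' k" for k
    using rt by (auto simp: n'_def m'_def d_def algebra_simps)
  define lo where "lo = (\<lambda>k. - c * upper (m' k) (n' k) - d k)"
  have val: "0 \<le> val m n" "val m n < q"
    and y: "q * lower m n \<le> conj_val m n" "conj_val m n \<le> q * upper m n"
    using assms by (auto simp: good_def)
  \<comment> \<open>The largest digit that may precede x, since (x + a) / \<beta> < 1 exactly if x <
    c. \<open>N\<close> indexes the largest candidate digit up to \<open>D\<close>.\<close>
  define D where "D = (if val m n < q * c then a else a - 1)"
  define N where "N = nat ((D - r) div b)"
  have rD: "r \<le> D" using r b_le_a by (auto simp: D_def)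
  then have "int N = (D - r) div b" using b_ge_1 by (simp add: N_def pos_imp_zdiv_nonneg_iff)
  then have "D - d N = (D - r) mod b" by (simp add: d_def minus_mult_div_eq_mod[symmetric])
  then have dN: "0 \<le> D - d N" "D - d N < b" using b_ge_1 by auto
  \<comment> \<open>As \<open>D - d N\<close> is a legitimate digit, the exact step identities
    apply, and tile \<open>N\<close> ends precisely at the lower bound of the fibre.\<close>
  have loN: "lower m n = lo N"
  proof (cases "val m n < q * c")
    case True
    then have "0 \<le> a - d N" "a - d N < b" using dN by (auto simp: D_def)
    from lower0_step_eq[OF this, of "n' N" "m' N"] show ?thesis
      using True by (simp add: lower_def lo_def m[symmetric] n[symmetric])
  next
    case False
    then have "0 \<le> a - 1 - d N" "a - 1 - d N < b" using dN by (auto simp: D_def)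
    from lower1_step_eq[OF this, of "n' N" "m' N"] show ?thesis
      using False by (simp add: lower_def lo_def m[symmetric] n[symmetric])
  qed
  \<comment> \<open>The interval of the conjugate is tiled, downwards from the upper bound, by the images of the fibres
    of the preimages with digits \<open>r\<close>, \<open>r + b\<close>, ...; the image for \<open>d k\<close> ends at \<open>lo k\<close>.\<close>
  define k where "k = (LEAST k. q * lo k \<le> conj_val m n)"
  have exN: "q * lo N \<le> conj_val m n" using y(1) loN by simp
  then have k: "q * lo k \<le> conj_val m n" unfolding k_def by (rule LeastI)
  have "k \<le> N" using exN unfolding k_def by (rule Least_le)
  have "b * int k \<le> b * int N" using \<open>k \<le> N\<close> b_ge_1 by (intro mult_left_mono) auto
  then have dk: "d k \<le> D" using dN(1) unfolding d_def by linarith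
  have d0: "0 \<le> d k" using r b_ge_1 by (simp add: d_def)
  have bv: "\<beta> * val (m' k) (n' k) = val m n + q * d k"
    using val_step[of "n' k" "d k" "m' k"] by (simp add: m[symmetric] n[symmetric])
  have val': "0 \<le> val (m' k) (n' k)"
  proof -
    have "0 \<le> \<beta> * val (m' k) (n' k)" unfolding bv using val q d0 by simp
    then show ?thesis using beta_pos by (simp add: zero_le_mult_iff)
  qed
  have "val m n + q * real_of_int D < q * \<beta>"
  proof (cases "val m n < q * c")
    case True
    then show ?thesis by (simp add: D_def beta_eq algebra_simps)
  next
    case False
    have "0 < q * c" using q c_pos by simp
    then show ?thesis using False val by (simp add: D_def beta_eq algebra_simps)
  qed
  moreover have "q * real_of_int (d k) \<le> q * real_of_int D" using q dk by simp
  ultimately have "\<beta> * val (m' k) (n' k) < \<beta> * q" unfolding bv by (simp add: mult.commute)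
  then have val'': "val (m' k) (n' k) < q" using beta_pos by simp
  have bqc: "\<beta> * (q * c) = of_int q * of_int b" by (rule beta_q_c)
  have hi: "conj_val m n \<le> q * (- c * lower (m' k) (n' k) - d k)"
  proof (cases k)
    case 0
    have "q * real_of_int (d k) \<le> q * (real_of_int b - 1)" using q r 0 by (simp add: d_def)
    then have "\<beta> * val (m' k) (n' k) < \<beta> * (q * c)"
      unfolding bv bqc using val by (simp add: algebra_simps)
    then have "val (m' k) (n' k) < q * c" using beta_pos by simp
    moreover have "d k < b" using r 0 by (simp add: d_def)
    then have "upper m n = - c * lower0 (m' k) (n' k) - d k"
      using upper_step_eq[OF d0, of "n' k" "m' k"] by (simp add: m[symmetric] n[symmetric])
    ultimately show ?thesis using y by (simp add: lower_def)
  next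
    case (Suc j)
    have "b \<le> d k" using r b_ge_1 by (simp add: d_def Suc distrib_left)
    then have "q * real_of_int b \<le> q * real_of_int (d k)" using q by simp
    then have "\<beta> * (q * c) \<le> \<beta> * val (m' k) (n' k)"
      unfolding bv bqc of_int_mult using val by linarith
    then have "\<not> val (m' k) (n' k) < q * c" using beta_pos by simp
    \<comment> \<open>Candidate point \<open>k\<close> is candidate point \<open>j\<close> plus
      \<beta> - a, so its \<open>lower1\<close> is the upper end for \<open>j\<close> minus \<beta>.
      With \<beta> c = b and \<open>d k = d j + b\<close>, consecutive tiles abut, and minimality of
      \<open>k\<close> puts y below \<open>lo j\<close>.\<close>
    moreover have l1: "lower1 (m' k) (n' k) = upper (m' j) (n' j) - \<beta>"
      by (simp add: lower1_def upper_def m'_def n'_def Suc algebra_simps)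
    have "- c * lower1 (m' k) (n' k) - d k = lo j"
      unfolding l1 lo_def using beta_c by (simp add: d_def Suc algebra_simps)
    moreover have "\<not> q * lo j \<le> conj_val m n"
      using Suc not_less_Least[of j "\<lambda>k. q * lo k \<le> conj_val m n"] by (simp add: k_def)
    ultimately show ?thesis by (simp add: lower_def)
  qed
  have cv: "conj_val m n = - c * conj_val (m' k) (n' k) - q * d k"
    using conj_step[of "n' k" "d k" "m' k"] by (simp add: m[symmetric] n[symmetric])
  have "c * (q * lower (m' k) (n' k)) \<le> c * conj_val (m' k) (n' k)"
    using hi unfolding cv by (simp add: algebra_simps)
  then have "q * lower (m' k) (n' k) \<le> conj_val (m' k) (n' k)"
    using c_pos by (simp only: mult_le_cancel_left_pos)
  moreover have "c * conj_val (m' k) (n' k) \<le> c * (q * upper (m' k) (n' k))"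
    using k unfolding cv lo_def by (simp add: algebra_simps)
  then have "conj_val (m' k) (n' k) \<le> q * upper (m' k) (n' k)"
    using c_pos by (simp only: mult_le_cancel_left_pos)
  ultimately have "good (m' k) (n' k)"
    using val' val'' by (simp add: good_def)
  moreover have "\<beta> * (val (m' k) (n' k) / q) = val m n / q + d k"
    unfolding times_divide_eq_right bv using q by (simp add: add_divide_distrib)
  then have "\<lfloor>\<beta> * (val (m' k) (n' k) / q)\<rfloor> = d k"
    using q val by (intro floor_unique) auto
  then have "step (m' k, n' k) = (m, n)"
    by (simp add: step_def m[symmetric] n[symmetric])
  ultimately show ?thesis by (rule that)
qed

text \<open>Both embeddings are bounded on the domain and together determine the point.
  \<open>K\<close> bounds the conjugate, which bounds \<open>n\<close> because n (\<beta> + c) is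
  the difference of the embeddings; then \<open>Z\<close> bounds n \<beta>, which bounds
  \<open>m\<close>.\<close>

lemma finite_good: "finite {p. case_prod good p}"
proof -
  have q: "0 < real_of_int q" using q_pos by simp
  define K where "K = q * (1 + \<beta> + B)"
  define Z where "Z = (q + K) * \<beta>"
  define C where "C = \<lceil>q + Z\<rceil>"
  have cB: "c * B \<le> B" using B_nonneg c_less_1 c_pos mult_right_mono[of c 1 B] by simp
  have K0: "0 \<le> K" using q beta_gt_1 B_nonneg by (simp add: K_def)
  have "\<bar>m\<bar> \<le> C \<and> \<bar>n\<bar> \<le> C" if "good m n" for m n
  proof -
    have g: "0 \<le> val m n" "val m n < q"
      "q * lower m n \<le> conj_val m n" "conj_val m n \<le> q * upper m n"
      using that by (auto simp: good_def)
    have "upper m n \<le> 1 + \<beta> + B" using f_le_B[of "m - q" n] beta_gt_1 by (simp add: upper_def)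
    then have "q * upper m n \<le> K" unfolding K_def using q by (intro mult_left_mono) auto
    then have 1: "conj_val m n \<le> K" using g(4) by simp
    have "- (1 + \<beta> + B) \<le> lower m n"
      using f_ge[of "m + a * q" "n - q"] f_ge[of "m - q + a * q" "n - q"] cB
      by (auto simp: lower_def lower0_def lower1_def)
    then have "q * (- (1 + \<beta> + B)) \<le> q * lower m n" using q by (intro mult_left_mono) auto
    then have 2: "- K \<le> conj_val m n" using g(3) unfolding K_def by linarith
    have "n * (\<beta> + c) = val m n - conj_val m n" by (simp add: val_def conj_val_def algebra_simps)
    then have "\<bar>n * (\<beta> + c)\<bar> \<le> q + K" using g 1 2 by linarith
    then have "\<bar>real_of_int n\<bar> * (\<beta> + c) \<le> q + K" using beta_gt_1 c_pos by (simp add: abs_mult)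
    moreover have "\<bar>real_of_int n\<bar> * 1 \<le> \<bar>real_of_int n\<bar> * (\<beta> + c)"
      using beta_gt_1 c_pos by (intro mult_left_mono) auto
    ultimately have n: "\<bar>real_of_int n\<bar> \<le> q + K" by simp
    then have nb: "\<bar>real_of_int n\<bar> * \<beta> \<le> Z" using beta_gt_1 by (unfold Z_def, intro mult_right_mono) auto
    have "real_of_int m = val m n - n * \<beta>" by (simp add: val_def)
    then have "\<bar>real_of_int m\<bar> \<le> \<bar>val m n\<bar> + \<bar>n * \<beta>\<bar>" by linarith
    also have "\<bar>n * \<beta>\<bar> = \<bar>real_of_int n\<bar> * \<beta>" using beta_gt_1 by (simp add: abs_mult)
    also have "\<bar>val m n\<bar> + \<bar>real_of_int n\<bar> * \<beta> \<le> q + Z" using nb g by linarith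
    finally have m: "\<bar>real_of_int m\<bar> \<le> q + Z" .
    have "(q + K) * 1 \<le> Z" unfolding Z_def using q K0 beta_gt_1 by (intro mult_left_mono) auto
    then have "q + K \<le> Z" by simp
    then have n': "\<bar>real_of_int n\<bar> \<le> q + Z" using n q by linarith
    show ?thesis using m n' unfolding C_def by (metis le_of_int_ceiling of_int_abs of_int_le_iff order_trans)
  qed
  then have "{p. case_prod good p} \<subseteq> {-C..C} \<times> {-C..C}" by (auto simp: abs_le_iff) force+
  then show ?thesis by (rule finite_subset) simp
qed

lemma good_imp_periodic:
  assumes "good m n"
  shows "purely_periodic_beta_exp \<beta> (val m n / q)"
proof -
  have "{p. case_prod good p} \<subseteq> step ` {p. case_prod good p}"
  proof
    fix p assume "p \<in> {p. case_prod good p}"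
    then obtain m n where "p = (m, n)" "good m n" by auto
    then show "p \<in> step ` {p. case_prod good p}"
      by (metis (mono_tags, lifting) good_pred case_prod_conv image_eqI mem_Collect_eq)
  qed
  from finite_surj_periodic[OF finite_good this, of "(m, n)"] assms
  obtain p where p: "p \<ge> 1" "(step ^^ p) (m, n) = (m, n)" by auto
  then have "(beta_T \<beta> ^^ p) (val m n / q) = val m n / q"
    using val_funpow_step[of p "(m, n)"] by simp
  then show ?thesis using p(1) assms q_pos
    by (subst purely_periodic_iff[OF beta_gt_1]) (auto simp: good_def)
qed

section \<open>Values of \<open>f\<close> along arithmetic progressions\<close>

text \<open>As \<open>s\<close> is invertible modulo \<open>b\<close>, the residue of
  \<open>t\<close> selects the first digit. Putting \<open>t0 + b * t\<close> for \<open>t\<close>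
  and removing that digit leaves a progression with slopes \<open>u * b - a * s\<close> and
  \<open>s\<close>. The first is prime to \<open>b\<close> because \<open>a\<close> is, so the next
  digit is free as well.\<close>

lemma f_dense:
  assumes "coprime a b" "coprime s b"
  shows "\<exists>t. \<bar>f (m + s * t) (n + u * t) - f m0 n0\<bar> \<le> c ^ k * (2 * B)"
  using assms(2)
proof (induction k arbitrary: m n s u m0 n0)
  case 0
  then show ?case using f_diff_bound by simp
next
  case (Suc k)
  define r where "r = dg m0"
  define l0 where "l0 = qt m0"
  have m0: "m0 = q * r + b * l0" unfolding r_def l0_def by (rule dg_qt)
  have r: "0 \<le> r" "r < b" by (auto simp: r_def dg_bounds)
  obtain v where "[s * v = 1] (mod b)" using Suc.prems cong_solve_coprime_int by blast
  then obtain w where w: "s * v = 1 + b * w" by (metis cong_iff_lin cong_sym)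
  define t0 where "t0 = v * (q * r - m)"
  define l where "l = w * (q * r - m)"
  have t0: "m + s * t0 = q * r + b * l"
  proof -
    have "m + s * t0 = m + (s * v) * (q * r - m)" by (simp add: t0_def)
    also have "\<dots> = q * r + b * l" unfolding w by (simp add: l_def algebra_simps)
    finally show ?thesis .
  qed
  have "coprime (u * b - a * s) b"
  proof (rule coprimeI)
    fix x assume x: "x dvd u * b - a * s" "x dvd b"
    then have "x dvd u * b" by simp
    from dvd_diff[OF this x(1)] have "x dvd u * b - (u * b - a * s)" .
    also have "u * b - (u * b - a * s) = a * s" by simp
    finally have "x dvd a * s" .
    moreover have "coprime (a * s) b" using assms(1) Suc.prems by simp
    ultimately show "is_unit x" using x(2) by (meson coprime_common_divisor)
  qed
  from Suc.IH[OF this, of "n + u * t0 - a * l" l s "n0 - a * l0" l0]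
  obtain t where t: "\<bar>f (n + u * t0 - a * l + (u * b - a * s) * t) (l + s * t) - f (n0 - a * l0) l0\<bar>
      \<le> c ^ k * (2 * B)" by blast
  have "m + s * (t0 + b * t) = q * r + b * (l + s * t)" using t0 by (simp add: algebra_simps)
  then have 1: "f (m + s * (t0 + b * t)) (n + u * (t0 + b * t)) =
      of_int r - c * f (n + u * t0 - a * l + (u * b - a * s) * t) (l + s * t)"
    by (simp only: f_split[OF r]) (simp add: algebra_simps)
  have 2: "f m0 n0 = of_int r - c * f (n0 - a * l0) l0" by (simp add: m0 f_split[OF r])
  have "\<bar>f (m + s * (t0 + b * t)) (n + u * (t0 + b * t)) - f m0 n0\<bar> =
      c * \<bar>f (n + u * t0 - a * l + (u * b - a * s) * t) (l + s * t) - f (n0 - a * l0) l0\<bar>"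
    unfolding 1 2 using c_pos by (simp add: abs_if algebra_simps)
  also have "\<dots> \<le> c * (c ^ k * (2 * B))" using t c_pos by (intro mult_left_mono) auto
  finally show ?case by (intro exI[of _ "t0 + b * t"]) simp
qed

text \<open>The even digits can be chosen to be 0, and then the odd ones only decrease \<open>f\<close>.\<close>
lemma f_small:
  assumes "a = b" "coprime s b"
  shows "\<exists>t. f (m + s * t) (n + u * t) \<le> c ^ (2 * k) * B"
  using assms(2)
proof (induction k arbitrary: m n s u)
  case 0
  then show ?case using f_le_B by simp
next
  case (Suc k)
  obtain v where "[s * v = 1] (mod b)" using Suc.prems cong_solve_coprime_int by blast
  then obtain w where w: "s * v = 1 + b * w" by (metis cong_iff_lin cong_sym)
  define t0 where "t0 = - v * m"
  define l where "l = - w * m"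
  have t0: "m + s * t0 = b * l"
  proof -
    have "m + s * t0 = m - (s * v) * m" by (simp add: t0_def)
    also have "\<dots> = b * l" unfolding w by (simp add: l_def algebra_simps)
    finally show ?thesis .
  qed
  define m1 where "m1 = n + u * t0 - b * l"
  define r where "r = dg m1"
  define l1 where "l1 = qt m1"
  have m1: "m1 = q * r + b * l1" unfolding r_def l1_def by (rule dg_qt)
  have r: "0 \<le> r" "r < b" by (auto simp: r_def dg_bounds)
  have b0: "0 \<le> (0::int)" "0 < b" using b_ge_1 by auto
  \<comment> \<open>For a = b the slope after one step is divisible by \<open>b\<close>, which
    forces the odd digit \<open>r\<close>; after two steps it is congruent to \<open>s\<close>
    modulo \<open>b\<close>, so the next even digit is free again.\<close>
  have "coprime (s * (1 + b) - b * u) b"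
  proof -
    have "s * (1 + b) - b * u = (s - u) * b + s" by (simp add: algebra_simps)
    then show ?thesis using Suc.prems gcd_add_mult[of b "s - u" s]
      by (simp add: coprime_iff_gcd_eq_1 gcd.commute)
  qed
  from Suc.IH[OF this, of "l - b * l1" l1 "u - s"]
  obtain t where t: "f (l - b * l1 + (s * (1 + b) - b * u) * t) (l1 + (u - s) * t) \<le> c ^ (2 * k) * B"
    by blast
  have "m + s * (t0 + b * t) = q * 0 + b * (l + s * t)" using t0 by (simp add: algebra_simps)
  then have "f (m + s * (t0 + b * t)) (n + u * (t0 + b * t)) =
      - c * f (n + u * (t0 + b * t) - b * (l + s * t)) (l + s * t)"
    by (simp only: f_split[OF b0]) (simp add: assms(1))
  also have "n + u * (t0 + b * t) - b * (l + s * t) = q * r + b * (l1 + (u - s) * t)"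
    using m1 unfolding m1_def by (simp add: algebra_simps)
  also have "f (q * r + b * (l1 + (u - s) * t)) (l + s * t) =
      of_int r - c * f (l - b * l1 + (s * (1 + b) - b * u) * t) (l1 + (u - s) * t)"
    by (simp only: f_split[OF r]) (simp add: assms(1) algebra_simps)
  also have "- c * (of_int r - c * f (l - b * l1 + (s * (1 + b) - b * u) * t) (l1 + (u - s) * t))
     \<le> c * c * f (l - b * l1 + (s * (1 + b) - b * u) * t) (l1 + (u - s) * t)"
    using r c_pos by (simp add: algebra_simps)
  also have "\<dots> \<le> c * c * (c ^ (2 * k) * B)"
    using t by (intro mult_left_mono) auto
  finally show ?case by (intro exI[of _ "t0 + b * t"]) (simp add: power2_eq_square)
qed

end

section \<open>Identification of \<open>f\<close> on the integers with the \<beta>-adic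
  series\<close>

context quad
begin

lemma quad_lattice_1: "quad_lattice a b \<beta> c 1 1"
  by unfold_locales auto

definition fint :: "int \<Rightarrow> real" where "fint j = quad_lattice.f a b c 1 1 j 0"

lemma bdd_below_fint: "bdd_below (range fint)"
proof -
  interpret one: quad_lattice a b \<beta> c 1 1 by (rule quad_lattice_1)
  show ?thesis unfolding fint_def bdd_below_def using one.f_ge by blast
qed

lemma Zbeta_iff: "x \<in> Zbeta \<beta> \<longleftrightarrow> (\<exists>m n. x = of_int m + of_int n * \<beta>)"
proof
  have "\<exists>m n. poly (map_poly of_int p) \<beta> = of_int m + of_int n * \<beta>" for p :: "int poly"
  proof (induction p)
    case (pCons d p)
    then obtain m n where mn: "poly (map_poly of_int p) \<beta> = of_int m + of_int n * \<beta>" by blast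
    have "poly (map_poly of_int (pCons d p)) \<beta> = of_int d + of_int m * \<beta> + of_int n * (\<beta> * \<beta>)"
      using pCons.hyps by (simp add: map_poly_pCons mn algebra_simps)
    also have "\<dots> = of_int (d + n * b) + of_int (m + n * a) * \<beta>"
      by (simp add: beta_square algebra_simps)
    finally show ?case by blast
  qed (auto intro!: exI[of _ 0])
  then show "\<exists>m n. x = of_int m + of_int n * \<beta>" if "x \<in> Zbeta \<beta>"
    using that unfolding Zbeta_def by blast
next
  assume "\<exists>m n. x = of_int m + of_int n * \<beta>"
  then obtain m n where x: "x = of_int m + of_int n * \<beta>" by blast
  have "x = poly (map_poly of_int [:m, n:]) \<beta>" by (simp add: x map_poly_pCons)
  then show "x \<in> Zbeta \<beta>" unfolding Zbeta_def by blast
qed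

text \<open>Peeling off digits yields the divisibility by \<open>\<beta> ^ k\<close>. For
  uniqueness, the first two digits that differ would differ by an integer in \<beta> Z[\<beta>], and
  such an integer is a multiple of \<open>b\<close> by linear independence.\<close>

lemma P_word_beta_adic: "P_word (beta_adic \<beta> b (of_int j)) (- c) = fint j"
proof -
  interpret one: quad_lattice a b \<beta> c 1 1 by (rule quad_lattice_1)
  let ?S = "\<lambda>u n. of_int j - (\<Sum>i<n. of_int (u i) * \<beta> ^ i)"
  have expand: "\<exists>m' n'. of_int m + of_int n * \<beta> - (\<Sum>i<k. of_int (one.digit i m n) * \<beta> ^ i) =
      \<beta> ^ k * (of_int m' + of_int n' * \<beta>)" for k m n
  proof (induction k arbitrary: m n)
    case (Suc k)
    define r where "r = one.dg m"
    define t where "t = one.qt m"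
    have m: "m = r + b * t" unfolding r_def t_def using one.dg_qt[of m] by simp
    from Suc[of "n - a * t" t] obtain m' n' where
      *: "of_int (n - a * t) + of_int t * \<beta> - (\<Sum>i<k. of_int (one.digit i (n - a * t) t) * \<beta> ^ i) =
        \<beta> ^ k * (of_int m' + of_int n' * \<beta>)" by blast
    have "(\<Sum>i<Suc k. of_int (one.digit i m n) * \<beta> ^ i) =
        of_int r + \<beta> * (\<Sum>i<k. of_int (one.digit i (n - a * t) t) * \<beta> ^ i)"
      by (subst sum.lessThan_Suc_shift)
        (simp add: r_def t_def sum_distrib_left ac_simps)
    also have "(\<Sum>i<k. of_int (one.digit i (n - a * t) t) * \<beta> ^ i) =
        of_int (n - a * t) + of_int t * \<beta> - \<beta> ^ k * (of_int m' + of_int n' * \<beta>)"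
      using * by linarith
    also have "of_int r + \<beta> * (of_int (n - a * t) + of_int t * \<beta> - \<beta> ^ k * (of_int m' + of_int n' * \<beta>)) =
        of_int r + of_int (n - a * t) * \<beta> + of_int t * (\<beta> * \<beta>) - \<beta> ^ Suc k * (of_int m' + of_int n' * \<beta>)"
      by (simp add: algebra_simps)
    also have "\<dots> = of_int m + of_int n * \<beta> - \<beta> ^ Suc k * (of_int m' + of_int n' * \<beta>)"
      unfolding beta_square by (simp add: m algebra_simps)
    finally have "of_int m + of_int n * \<beta> - (\<Sum>i<Suc k. of_int (one.digit i m n) * \<beta> ^ i) =
        \<beta> ^ Suc k * (of_int m' + of_int n' * \<beta>)" by linarith
    then show ?case by blast
  next
    case 0
    show ?case by (intro exI[of _ m] exI[of _ n]) simp
  qed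
  have "beta_adic \<beta> b (of_int j) = (\<lambda>i. one.digit i j 0)"
    unfolding beta_adic_def
  proof (rule the_equality, intro conjI allI)
    fix n
    show "0 \<le> one.digit n j 0" "one.digit n j 0 < b" by (rule one.digit_bounds)+
    show "?S (\<lambda>i. one.digit i j 0) n \<in> (\<lambda>y. \<beta> ^ n * y) ` Zbeta \<beta>"
    proof -
      obtain m' n' where "of_int j + of_int 0 * \<beta> - (\<Sum>i<n. of_int (one.digit i j 0) * \<beta> ^ i) =
          \<beta> ^ n * (of_int m' + of_int n' * \<beta>)" using expand by blast
      moreover have "of_int m' + of_int n' * \<beta> \<in> Zbeta \<beta>" unfolding Zbeta_iff by blast
      ultimately show ?thesis by (intro image_eqI) auto
    qed
  next
    fix v
    assume v: "(\<forall>n. 0 \<le> v n \<and> v n < b) \<and> (\<forall>n. ?S v n \<in> (\<lambda>y. \<beta> ^ n * y) ` Zbeta \<beta>)"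
    have "v n = one.digit n j 0" for n
    proof (induction n rule: less_induct)
      case (less n)
      have "?S v (Suc n) \<in> (\<lambda>y. \<beta> ^ Suc n * y) ` Zbeta \<beta>" using v by blast
      then obtain y where "?S v (Suc n) = \<beta> ^ Suc n * y" "y \<in> Zbeta \<beta>" by (rule imageE)
      then obtain m1 n1 where 1: "?S v (Suc n) = \<beta> ^ Suc n * (of_int m1 + of_int n1 * \<beta>)"
        unfolding Zbeta_iff by blast
      obtain m2 n2 where "of_int j + of_int 0 * \<beta> - (\<Sum>i<Suc n. of_int (one.digit i j 0) * \<beta> ^ i) =
          \<beta> ^ Suc n * (of_int m2 + of_int n2 * \<beta>)" using expand by blast
      then have 2: "?S (\<lambda>i. one.digit i j 0) (Suc n) = \<beta> ^ Suc n * (of_int m2 + of_int n2 * \<beta>)"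
        by simp
      have 3: "(\<Sum>i<n. of_int (v i) * \<beta> ^ i) = (\<Sum>i<n. of_int (one.digit i j 0) * \<beta> ^ i)"
        using less by (intro sum.cong) auto
      define d where "d = one.digit n j 0"
      have "?S (\<lambda>i. one.digit i j 0) (Suc n) - ?S v (Suc n) = of_int (v n - d) * \<beta> ^ n"
        by (simp add: 3 d_def algebra_simps)
      then have "\<beta> ^ n * of_int (v n - d) =
          \<beta> ^ n * (\<beta> * (of_int (m2 - m1) + of_int (n2 - n1) * \<beta>))"
        unfolding 1 2 by (simp add: algebra_simps)
      then have "of_int (v n - d) = \<beta> * (of_int (m2 - m1) + of_int (n2 - n1) * \<beta>)"
        using beta_gt_1 by (subst (asm) mult_cancel_left) auto
      also have "\<dots> = of_int (m2 - m1) * \<beta> + of_int (n2 - n1) * (\<beta> * \<beta>)"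
        by (simp add: algebra_simps)
      finally have "of_int (v n - d - (n2 - n1) * b) + of_int (- (m2 - m1) - (n2 - n1) * a) * \<beta> = 0"
        unfolding beta_square by (simp add: algebra_simps)
      then have eq: "v n - d = (n2 - n1) * b" using beta_lin_indep by fastforce
      have "0 \<le> v n" "v n < b" "0 \<le> d" "d < b"
        using v one.digit_bounds by (auto simp: d_def)
      then have "v n mod b = v n" "d mod b = d" by auto
      moreover have "v n mod b = d mod b" using eq by (simp add: mod_eq_dvd_iff)
      ultimately show ?case by (simp add: d_def)
    qed
    then show "v = (\<lambda>i. one.digit i j 0)" by blast
  qed
  then show ?thesis by (simp add: P_word_def fint_def one.f_def)
qed

end

section \<open>Rational points below the infimum and the lower fibre bound\<close>

context quad_lattice
begin

text \<open>Cancelling \<open>q\<close> in numerator and denominator does not change the digits;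
  this ties all denominators to the one function \<open>fint\<close>.\<close>

lemma f_int: "f (q * j) 0 = fint j"
proof -
  interpret one: quad_lattice a b \<beta> c 1 1 by (rule quad_lattice_1)
  have trunc: "ftrunc k (q * m) (q * n) = one.ftrunc k m n" for k m n
  proof (induction k arbitrary: m n)
    case (Suc k)
    have m: "m = one.dg m + b * one.qt m" using one.dg_qt[of m] by simp
    have "q * m = q * one.dg m + b * (q * one.qt m)"
      by (subst m) (simp add: algebra_simps)
    then have "dg (q * m) = one.dg m" "qt (q * m) = q * one.qt m"
      using dg_qt_unique one.dg_bounds by blast+
    then show ?case using Suc[of "n - a * one.qt m" "one.qt m"] by (simp add: algebra_simps)
  qed simp
  have "(\<lambda>k. ftrunc k (q * j) (q * 0)) \<longlonglongrightarrow> one.f j 0"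
    unfolding trunc by (rule one.ftrunc_tendsto)
  then have "f (q * j) (q * 0) = one.f j 0" by (rule LIMSEQ_unique[OF ftrunc_tendsto])
  then show ?thesis by (simp add: fint_def)
qed

lemma coprime_q: "coprime q b"
proof (rule coprimeI)
  fix x assume "x dvd q" "x dvd b"
  then have "x dvd q * qi" "x dvd q * qi - 1" using q_inv by (auto intro: dvd_trans)
  from dvd_diff[OF this] show "is_unit x" by simp
qed

text \<open>Inverting \<open>q\<close> modulo \<open>b ^ k\<close> produces an integer that is
  b-adically close to \<open>m / q\<close>.\<close>

lemma Inf_le_f: "(INF j. fint j) \<le> f m 0"
proof (rule le_of_geometric[OF less_imp_le[OF c_pos] c_less_1])
  fix k
  have "coprime q (b ^ k)" using coprime_q by simp
  then obtain v where "[q * v = 1] (mod b ^ k)" using cong_solve_coprime_int by blast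
  then obtain w where w: "q * v = 1 + b ^ k * w" by (metis cong_iff_lin cong_sym)
  have "q * (v * m) = (q * v) * m" by simp
  also have "\<dots> = m + b ^ k * (w * m)" unfolding w by (simp add: algebra_simps)
  finally have eq: "q * (v * m) = m + b ^ k * (w * m)" .
  have "\<bar>f (m + b ^ k * (w * m)) (0 + b ^ k * 0) - f m 0\<bar> \<le> c ^ k * (2 * B)" by (rule f_approx)
  then have "fint (v * m) \<le> f m 0 + c ^ k * (2 * B)"
    unfolding f_int[symmetric] eq by simp
  moreover have "(INF j. fint j) \<le> fint (v * m)" by (rule cINF_lower[OF bdd_below_fint]) simp
  ultimately show "(INF j. fint j) \<le> f m 0 + c ^ k * (2 * B)" by simp
qed

lemma val_0: "val m 0 = of_int m" "conj_val m 0 = of_int m"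
  by (simp_all add: val_def conj_val_def)

lemma good_below_Inf:
  assumes "0 \<le> m" "m < q" "of_int m < q * (1 + (INF j. fint j))" "q * lower m 0 \<le> of_int m"
  shows "good m 0"
proof -
  have "q * (1 + (INF j. fint j)) \<le> q * upper m 0"
    unfolding upper_def using Inf_le_f q_pos by (intro mult_left_mono) auto
  then have "of_int m \<le> q * upper m 0" using assms(3) by linarith
  then show ?thesis using assms by (simp add: good_def val_0)
qed

text \<open>The bound on \<open>f\<close> gives \<open>lower0\<close> at most c - 1, which is
  negative, and \<open>lower1\<close> at most \<open>c\<close>; the latter matters only for x \<ge>
  c.\<close>

lemma lower_le:
  assumes "\<And>m n. f m n \<le> \<beta> - 1 + c" "0 \<le> m"
  shows "q * lower m 0 \<le> of_int m"
proof (cases "of_int m < q * c")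
  case True
  then have "lower m 0 \<le> 0"
    using assms(1)[of "m + a * q" "- q"] c_less_1 by (simp add: lower_def lower0_def val_0)
  then have "q * lower m 0 \<le> of_int q * 0" using q_pos by (intro mult_left_mono) auto
  then show ?thesis using assms by simp
next
  case False
  then have "lower m 0 \<le> c"
    using assms(1)[of "m - q + a * q" "- q"] by (simp add: lower_def lower1_def val_0)
  then have "q * lower m 0 \<le> q * c" using q_pos by (intro mult_left_mono) auto
  then show ?thesis using False by simp
qed

text \<open>For the golden ratio g, the inequalities a > g b and c a < b give c g < 1, so 1 - c^2 >
  1 - 1/g^2 = 1/g. Hence B \<le> g (b - 1) < a - g.\<close>

lemma f_le_golden:
  assumes "of_int a > (1 + sqrt 5) / 2 * of_int b"
  shows "f m n \<le> \<beta> - 1 + c"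
proof -
  define g where "g = (1 + sqrt 5) / (2::real)"
  have g2: "g * g = g + 1"
    by (simp add: g_def field_simps)
  have g1: "1 < g" by (simp add: g_def)
  have ag: "g * of_int b < of_int a" using assms by (simp add: g_def)
  have "c * of_int a < of_int b"
    using beta_c c_pos by (simp add: beta_eq algebra_simps) (smt (verit) mult_pos_pos)
  then have "c * (g * of_int b) < of_int b"
    using ag c_pos by (smt (verit) mult_strict_left_mono)
  then have "(c * g) * of_int b < 1 * of_int b" by (simp add: mult.assoc)
  then have cg: "c * g < 1" using b_ge_1 by (subst (asm) mult_less_cancel_right_pos) auto
  have "(c * g) * (c * g) < 1" using cg c_pos g1 mult_strict_mono[of "c * g" 1 "c * g" 1] by simp
  then have "c * c * (g * g) < 1" by (simp add: algebra_simps)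
  then have "1 \<le> g * (1 - c * c)"
  proof -
    have "c * c * (g * g) < g * g - g" using \<open>c * c * (g * g) < 1\<close> g2 by simp
    then have "g * (c * c * g) < g * (g - 1)" by (simp add: algebra_simps)
    then have "c * c * g < g - 1" using g1 by simp
    then show ?thesis by (simp add: algebra_simps)
  qed
  then have "(of_int b - 1) * 1 \<le> (of_int b - 1) * (g * (1 - c * c))"
    using b_ge_1 by (intro mult_left_mono) auto
  also have "\<dots> = (g * of_int b - g) * (1 - c * c)" by (simp add: algebra_simps)
  also have "\<dots> \<le> (\<beta> - 1 + c) * (1 - c * c)"
    using one_minus_cc ag g1 c_pos beta_gt_a by (intro mult_right_mono) auto
  finally have "B \<le> \<beta> - 1 + c" by (simp add: B_le_iff)
  then show ?thesis using f_le_B[of m n] by linarith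
qed

text \<open>Prefixing the digit 0 turns a value of \<open>f\<close> into - c times that value, which
  by density is a limit of values at integers. These exceed -1, so \<open>c * f m n\<close> is at
  most 1, and b \<ge> 2 makes 1 at most c (\<beta> - 1 + c).\<close>

lemma f_le_coprime:
  assumes "coprime a b" "2 \<le> b" "0 < 1 + (INF j. fint j)"
  shows "f m n \<le> \<beta> - 1 + c"
proof -
  have "c * f m n \<le> 1"
  proof (rule le_of_geometric[OF less_imp_le[OF c_pos] c_less_1])
    fix k
    obtain t where t: "\<bar>f (0 + q * t) (0 + 0 * t) - f (q * 0 + b * n) (m + a * n)\<bar> \<le> c ^ k * (2 * B)"
      using f_dense[OF assms(1) coprime_q] by blast
    have "f (q * 0 + b * n) (m + a * n) = of_int 0 - c * f m n"
      using assms(2) by (intro f_beta_mult) auto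
    then have "fint t \<le> - c * f m n + c ^ k * (2 * B)" using t f_int[of t] by simp
    moreover have "(INF j. fint j) \<le> fint t" by (rule cINF_lower[OF bdd_below_fint]) simp
    ultimately show "c * f m n \<le> 1 + c ^ k * (2 * B)" using assms(3) by simp
  qed
  also have "1 \<le> c * (\<beta> - 1 + c)"
  proof -
    have "c * (\<beta> - 1 + c) = of_int b - c + c * c" using beta_c by (simp add: algebra_simps)
    moreover have "2 \<le> real_of_int b" using assms(2) by simp
    moreover have "0 \<le> c * c" by simp
    ultimately show ?thesis using c_less_1 by linarith
  qed
  finally show ?thesis using c_pos by simp
qed

lemma f_le_small:
  assumes "b = 1 \<or> a = 2 \<and> b = 2"
  shows "f m n \<le> \<beta> - 1 + c"
proof -
  have "B \<le> \<beta> - 1 + c"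
    using assms
  proof
    assume "b = 1"
    moreover have "0 \<le> (\<beta> - 1 + c) * (1 - c * c)"
      using beta_gt_1 c_pos one_minus_cc by (intro mult_nonneg_nonneg) auto
    ultimately show ?thesis unfolding B_le_iff by simp
  next
    assume ab: "a = 2 \<and> b = 2"
    then have cc: "c * c = 2 - 2 * c" using c_square by simp
    \<comment> \<open>With c^2 = 2 - 2 c the required inequality is 1 \<le> 4 c^2 - 1, that is c
      \<le> 3/4.\<close>
    have "c \<le> 3/4"
    proof (rule ccontr)
      assume "\<not> c \<le> 3/4"
      then have "3/4 * (3/4) \<le> c * c" by (intro mult_mono) auto
      then show False using cc \<open>\<not> c \<le> 3/4\<close> by simp
    qed
    moreover have 1: "1 - c * c = 2 * c - 1" using cc by simp
    have "(\<beta> - 1 + c) * (1 - c * c) = 4 * (c * c) - 1"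
      unfolding 1 using ab by (simp add: beta_eq algebra_simps)
    ultimately show ?thesis unfolding B_le_iff using ab cc by simp
  qed
  then show ?thesis using f_le_B[of m n] by linarith
qed

end

section \<open>The diagonal case a = b\<close>

context quad
begin

text \<open>The integers \<open>b (1 + b N)\<close> have expansions starting with the digits \<open>0, 0, 1, b - 1\<close>.\<close>
lemma Inf_fint_le:
  assumes "a = b" "2 \<le> b"
  shows "(INF j. fint j) \<le> c * c * (1 - (of_int b - 1) * c)"
proof -
  interpret one: quad_lattice a b \<beta> c 1 1 by (rule quad_lattice_1)
  have fi: "fint (b * (1 + b * N)) = c * c * (1 - c * ((of_int b - 1) -
      c * one.f ((1 + 2 * b) + (1 + 3 * b + b * b) * N) (- 2 + (- b - 2) * N)))" for N
  proof -
    define t0 where "t0 = 1 + b * N"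
    define t2 where "t2 = 1 + N + b * N"
    define t3 where "t3 = - 2 + (- b - 2) * N"
    have r: "0 \<le> (0::int)" "0 < b" "0 \<le> (1::int)" "1 < b" "0 \<le> b - 1" "b - 1 < b"
      using assms(2) by auto
    have "fint (b * t0) = - c * one.f (- (b * t0)) t0"
      unfolding fint_def using one.f_split[OF r(1,2), of t0 0] by (simp add: assms(1))
    also have "one.f (- (b * t0)) t0 = - c * one.f (t0 + b * t0) (- t0)"
      using one.f_split[OF r(1,2), of "- t0" t0] by (simp add: assms(1))
    also have "t0 + b * t0 = 1 * 1 + b * t2" by (simp add: t0_def t2_def algebra_simps)
    also have "one.f (1 * 1 + b * t2) (- t0) = 1 - c * one.f (- t0 - b * t2) t2"
      using one.f_split[OF r(3,4), of t2 "- t0"] by (simp add: assms(1))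
    also have "- t0 - b * t2 = 1 * (b - 1) + b * t3"
      by (simp add: t0_def t2_def t3_def algebra_simps)
    also have "one.f (1 * (b - 1) + b * t3) t2 = of_int b - 1 - c * one.f (t2 - b * t3) t3"
      using one.f_split[OF r(5,6), of t3 t2] by (simp add: assms(1))
    also have "t2 - b * t3 = (1 + 2 * b) + (1 + 3 * b + b * b) * N"
      by (simp add: t2_def t3_def algebra_simps)
    finally show ?thesis by (simp add: t0_def t3_def)
  qed
  \<comment> \<open>The slope of the tail in \<open>N\<close> is prime to \<open>b\<close>, so
    \<open>f_small\<close> brings the tail below any positive bound.\<close>
  have "coprime (1 + 3 * b + b * b) b"
  proof -
    have eq: "1 + 3 * b + b * b = (3 + b) * b + 1" by (simp add: algebra_simps)
    show ?thesis
      unfolding eq coprime_iff_gcd_eq_1 by (simp only: gcd.commute[of _ b] gcd_add_mult) simp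
  qed
  note small = one.f_small[OF assms(1) this, where m = "1 + 2 * b" and n = "- 2" and u = "- b - 2"]
  show ?thesis
  proof (rule le_of_geometric[OF less_imp_le[OF c_pos] c_less_1])
    fix k
    obtain N where N: "one.f ((1 + 2 * b) + (1 + 3 * b + b * b) * N) (- 2 + (- b - 2) * N) \<le> c ^ (2 * k) * B"
      using small by blast
    let ?g = "one.f ((1 + 2 * b) + (1 + 3 * b + b * b) * N) (- 2 + (- b - 2) * N)"
    have "c ^ (2 * k) * B \<le> c ^ k * B"
      using c_pos c_less_1 B_nonneg by (intro mult_right_mono power_decreasing) auto
    then have g: "?g \<le> c ^ k * B" using N by simp
    have "(INF j. fint j) \<le> fint (b * (1 + b * N))" by (rule cINF_lower[OF bdd_below_fint]) simp
    also have "\<dots> = c * c * (1 - (of_int b - 1) * c) + c ^ 4 * ?g"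
      unfolding fi by (simp add: algebra_simps eval_nat_numeral)
    also have "c ^ 4 * ?g \<le> c ^ 4 * (c ^ k * B)"
      using g c_pos by (intro mult_left_mono) auto
    also have "c ^ 4 * (c ^ k * B) \<le> 1 * (c ^ k * B)"
      using c_pos c_less_1 B_nonneg by (intro mult_right_mono power_le_one mult_nonneg_nonneg) auto
    finally show "(INF j. fint j) \<le> c * c * (1 - (of_int b - 1) * c) + c ^ k * B" by simp
  qed
qed

text \<open>\<open>c\<close> is the positive root of X^2 + a X = b, whose left side increases for X
  \<ge> 0; numerical lower bounds for \<open>c\<close> thus need only one evaluation.\<close>

lemma c_ge:
  assumes "x * x + of_int a * x \<le> of_int b" "0 \<le> x"
  shows "x \<le> c"
proof (rule ccontr)
  assume "\<not> x \<le> c"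
  then have "c * c < x * x" "of_int a * c < of_int a * x"
    using c_pos assms(2) a_ge_1 by (auto intro: mult_strict_mono)
  then show False using assms(1) c_square by linarith
qed

end

context quad_lattice
begin

text \<open>For b \<le> 2 the uniform bound on \<open>f\<close> suffices. For b = 3 a forced digit
  settles x < c, and no x \<ge> c lies below 1 plus the infimum. For b \<ge> 4 that number is at
  most 0, which leaves no \<open>m\<close>.\<close>

lemma lower_le_diagonal:
  assumes "a = b" "0 \<le> m" "of_int m < q * (1 + (INF j. fint j))"
  shows "q * lower m 0 \<le> of_int m"
proof -
  consider "b = 1 \<or> a = 2 \<and> b = 2" | "b = 3" | "4 \<le> b" using assms(1) b_ge_1 by linarith
  then show ?thesis
  proof cases
    case 1
    then show ?thesis using f_le_small assms(2) by (intro lower_le) auto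
  next
    case 2
    have cc: "c * c = 3 - 3 * c" using c_square assms(1) 2 by simp
    have lo: "79/100 \<le> c" by (rule c_ge) (use assms(1) 2 in auto)
    \<comment> \<open>With c^2 = 3 - 3 c, the inequality B \<le> \<beta> + 2 c needed below becomes
      24 c \<le> 19.\<close>
    have hi: "c \<le> 19/24"
    proof (rule ccontr)
      assume "\<not> c \<le> 19/24"
      then have "19/24 * (19/24) \<le> c * c" by (intro mult_mono) auto
      then show False using cc \<open>\<not> c \<le> 19/24\<close> by simp
    qed
    show ?thesis
    proof (cases "of_int m < q * c")
      case True
      \<comment> \<open>After the first digit of x + \<beta>' the first coordinate is - q - a l,
        congruent to - q modulo 3, so the second digit is always 2. This lowers the bound
        \<open>B\<close> to B - 2 c.\<close>
      define l where "l = qt (m + a * q)"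
      have "f (q * 2 + b * (- q - l)) l = of_int 2 - c * f (l - a * (- q - l)) (- q - l)"
        using 2 by (intro f_split) auto
      moreover have "q * 2 + b * (- q - l) = 0 - q - a * l" using 2 assms(1) by simp
      moreover have "f (l - a * (- q - l)) (- q - l) \<le> B" by (rule f_le_B)
      then have "c * f (l - a * (- q - l)) (- q - l) \<le> c * B" using c_pos by simp
      ultimately have "2 - c * B \<le> f (0 - q - a * l) l" by simp
      then have "c * (2 - c * B) \<le> c * f (0 - q - a * l) l" using c_pos by simp
      moreover have "f (m + a * q) (0 - q) = of_int (dg (m + a * q)) - c * f (0 - q - a * l) l"
        unfolding l_def by (rule f_rec)
      moreover have "dg (m + a * q) \<le> 2" using dg_bounds[of "m + a * q"] 2 by simp
      ultimately have "f (m + a * q) (0 - q) \<le> 2 - c * (2 - c * B)" by linarith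
      also have "\<dots> = B - 2 * c" using B_eq 2 by (simp add: algebra_simps)
      also have "B \<le> \<beta> + 2 * c"
      proof -
        have 1: "1 - c * c = 3 * c - 2" using cc by simp
        have "(\<beta> + 2 * c) * (1 - c * c) = 9 * (c * c) + 3 * c - 6"
          unfolding 1 using assms(1) 2 by (simp add: beta_eq algebra_simps)
        then show ?thesis unfolding B_le_iff using cc hi 2 by simp
      qed
      finally have "lower m 0 \<le> 0" using True by (simp add: lower_def lower0_def val_0)
      then have "q * lower m 0 \<le> of_int q * 0" using q_pos by (intro mult_left_mono) auto
      then show ?thesis using assms by simp
    next
      case False
      then have "q * c < q * (1 + (INF j. fint j))" using assms(3) by linarith
      then have "c < 1 + (INF j. fint j)" using q_pos by simp
      also have "(INF j. fint j) \<le> c * c * (1 - 2 * c)"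
        using Inf_fint_le assms(1) 2 by simp
      finally have "c < 1 + c * c * (1 - 2 * c)" by simp
      moreover have "79/100 * (79/100) * (2 * (79/100) - 1) \<le> c * c * (2 * c - 1)"
        using lo by (intro mult_mono) auto
      ultimately show ?thesis using lo by (simp add: algebra_simps)
    qed
  next
    case 3
    have b4: "4 \<le> real_of_int b" using 3 by simp
    \<comment> \<open>Just below 2 sqrt 2 - 2, the value of \<open>c\<close> for b = 4; at this
      point c^2 (3 c - 1) already exceeds 1.\<close>
    have lo: "828/1000 \<le> c" by (rule c_ge) (use assms(1) b4 in auto)
    have "3 * (828/1000) \<le> (of_int b - 1) * c" using b4 lo by (intro mult_mono) auto
    then have "828/1000 * (828/1000) * (3 * (828/1000) - 1) \<le> c * c * ((of_int b - 1) * c - 1)"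
      using lo by (intro mult_mono) auto
    then have "1 \<le> c * c * ((of_int b - 1) * c - 1)" by simp
    then have "c * c * (1 - (of_int b - 1) * c) \<le> - 1" by (simp add: algebra_simps)
    then have "1 + (INF j. fint j) \<le> 0" using Inf_fint_le assms(1) 3 by simp
    then have "q * (1 + (INF j. fint j)) \<le> of_int q * 0" using q_pos by (intro mult_left_mono) auto
    then show ?thesis using assms by simp
  qed
qed

end

section \<open>The formula for \<gamma>(\<beta>)\<close>

context quad
begin

text \<open>The assumption isolates what the arithmetic condition on \<open>a\<close> and
  \<open>b\<close> has to supply: below 1 plus the infimum, the lower fibre bound holds.\<close>

lemma gamma_beta_eq:
  assumes lower: "\<And>q qi m. quad_lattice a b \<beta> c q qi \<Longrightarrow> 0 \<le> m \<Longrightarrow>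
    of_int m < of_int q * (1 + (INF j. fint j)) \<Longrightarrow>
    of_int q * quad_lattice.lower a b \<beta> c q qi m 0 \<le> of_int m"
  shows "gamma_beta \<beta> b = max 0 (1 + (INF j. fint j))"
proof -
  define I where "I = (INF j. fint j)"
  define G where "G = max 0 (1 + I)"
  define S where "S = {r. \<exists>p q :: int. q > 0 \<and> r = of_int p / of_int q \<and>
        0 \<le> r \<and> r < 1 \<and> coprime q b \<and> \<not> purely_periodic_beta_exp \<beta> r}"
  \<comment> \<open>This makes \<open>G\<close> at most 1, as it must be because 1 belongs to the
    set defining \<gamma>(\<beta>).\<close>
  have "fint 0 = 0"
  proof -
    interpret one: quad_lattice a b \<beta> c 1 1 by (rule quad_lattice_1)
    have "0 \<le> (0::int)" "0 < b" using b_ge_1 by auto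
    from one.f_split[OF this, of 0 0] have "(1 + c) * fint 0 = 0"
      by (simp add: fint_def algebra_simps)
    then show ?thesis using c_pos by simp
  qed
  moreover have "I \<le> fint 0" unfolding I_def by (rule cINF_lower[OF bdd_below_fint]) simp
  ultimately have G1: "G \<le> 1" by (simp add: G_def)
  have ge: "G \<le> r" if rS: "r \<in> S" for r
  proof -
    obtain p q :: int where pq: "q > 0" "r = of_int p / of_int q" "0 \<le> r" "r < 1"
      "coprime q b" "\<not> purely_periodic_beta_exp \<beta> r"
      using rS unfolding S_def by blast
    obtain qi where "[q * qi = 1] (mod b)" using cong_solve_coprime_int[OF pq(5)] by blast
    then have "b dvd q * qi - 1" by (simp add: cong_iff_dvd_diff)
    then interpret quad_lattice a b \<beta> c q qi using pq(1) by unfold_locales auto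
    have "\<not> r < 1 + I"
    proof
      assume "r < 1 + I"
      then have lt: "of_int p < of_int q * (1 + (INF j. fint j))"
        using pq by (simp add: I_def pos_divide_less_eq mult.commute)
      have p: "0 \<le> p" "p < q" using pq by (auto simp: zero_le_divide_iff)
      have "good p 0" using p lt lower[OF quad_lattice_axioms p(1) lt] by (rule good_below_Inf)
      from good_imp_periodic[OF this] show False using pq by (simp add: val_0)
    qed
    then show ?thesis using pq(3) by (simp add: G_def)
  qed
  have bdd: "bdd_below (S \<union> {1})" by (rule bdd_belowI[of _ G]) (use ge G1 in auto)
  have "Inf (S \<union> {1}) = G"
  proof (rule antisym)
    show "G \<le> Inf (S \<union> {1})" by (rule cInf_greatest) (use ge G1 in auto)
    show "Inf (S \<union> {1}) \<le> G"
    proof (rule field_le_epsilon)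
      fix e :: real assume e: "0 < e"
      show "Inf (S \<union> {1}) \<le> G + e"
      proof (cases "G + e < 1")
        case False
        have "Inf (S \<union> {1}) \<le> 1" using bdd by (intro cInf_lower) auto
        then show ?thesis using False by simp
      next
        case True
        have "(INF j. fint j) < I + e / 4" using e by (simp add: I_def)
        then have "\<exists>j\<in>UNIV. fint j < I + e / 4"
          by (subst (asm) cINF_less_iff[OF _ bdd_below_fint]) auto
        then obtain j where j: "fint j < I + e / 4" by blast
        obtain k where "c ^ k < e / (4 * (2 * B + 1))"
          using real_arch_pow_inv[of "e / (4 * (2 * B + 1))" c] e B_nonneg c_less_1 by auto
        then have "c ^ k * (2 * B + 1) < e / 4" using B_nonneg by (simp add: field_simps)
        moreover have "c ^ k * (2 * B) \<le> c ^ k * (2 * B + 1)" using c_pos by simp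
        ultimately have ck: "c ^ k * (2 * B) < e / 4" by linarith
        \<comment> \<open>The denominator 1 + b K has inverse 1 modulo \<open>b\<close> and is so
          large that fractions with numerators in one class modulo \<open>b ^ k\<close> are spaced
          by less than e/2.\<close>
        obtain K where K: "of_int b ^ k * 2 / e < real K" using reals_Archimedean2 by blast
        define q where "q = 1 + b * int K"
        have "1 * real K \<le> of_int b * real K" using b_ge_1 by (intro mult_right_mono) auto
        then have "of_int b ^ k * 2 / e < of_int q" using K by (simp add: q_def)
        then have bq: "of_int b ^ k < of_int q * (e / 2)" using e by (simp add: field_simps)
        have q: "0 < q" using b_ge_1 by (simp add: q_def add_pos_nonneg)
        interpret quad_lattice a b \<beta> c q 1 using q by unfold_locales (auto simp: q_def)
        define l where "l = G + e / 2"
        \<comment> \<open>This choice makes \<open>p\<close> the first numerator in the class of q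
          (j + 1) modulo \<open>b ^ k\<close> with p / q > l. Then p / q - 1 is b-adically close to
          \<open>j\<close>, so the upper fibre bound falls below \<open>l\<close> and p / q is not
          periodic.\<close>
        define t where "t = \<lfloor>of_int q * (l - of_int (j + 1)) / of_int b ^ k\<rfloor> + 1"
        define p where "p = q * (j + 1) + b ^ k * t"
        have bk: "0 < real_of_int b ^ k" using b_ge_1 by simp
        have "of_int q * (l - of_int (j + 1)) / of_int b ^ k < t"
          "of_int t - 1 \<le> of_int q * (l - of_int (j + 1)) / of_int b ^ k"
          unfolding t_def by linarith+
        then have "of_int q * (l - of_int (j + 1)) < of_int t * of_int b ^ k"
          "(of_int t - 1) * of_int b ^ k \<le> of_int q * (l - of_int (j + 1))"
          using bk by (simp_all only: pos_divide_less_eq pos_le_divide_eq)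
        then have p: "of_int q * l < of_int p" "of_int p < of_int q * (G + e)"
          using bq by (simp_all add: p_def l_def algebra_simps)
        have q': "0 < real_of_int q" using q by simp
        define r where "r = real_of_int p / of_int q"
        have r: "l < r" "r < G + e"
          using p q' by (simp_all add: r_def pos_less_divide_eq pos_divide_less_eq mult.commute)
        have "0 \<le> l" using e by (simp add: l_def G_def)
        have r01: "0 \<le> r" "r < 1" using r \<open>0 \<le> l\<close> True by linarith+
        have "val p 0 = r * of_int q" using q by (simp add: val_0 r_def)
        then have pr: "0 \<le> val p 0" "val p 0 < q" using r01 q' by auto
        have "\<not> purely_periodic_beta_exp \<beta> r"
        proof
          assume "purely_periodic_beta_exp \<beta> r"
          then have up: "of_int p \<le> q * upper p 0"
            using periodic_imp_upper[OF pr] by (simp add: val_0 r_def)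
          have "p - q = q * j + b ^ k * t" by (simp add: p_def algebra_simps)
          then have "\<bar>f (p - q) 0 - f (q * j) 0\<bar> \<le> c ^ k * (2 * B)"
            using f_approx[of "q * j" k t 0 0] by simp
          then have "upper p 0 < l"
            using j ck f_int[of j] by (simp add: upper_def l_def G_def)
          then have "q * upper p 0 < q * l" using q' by simp
          then show False using up p by simp
        qed
        moreover have "coprime q b" by (rule coprime_q)
        ultimately have "r \<in> S"
          unfolding S_def using q r01 r_def
          by (intro CollectI exI[of _ p] exI[of _ q]) auto
        then have "Inf (S \<union> {1}) \<le> r" using bdd by (intro cInf_lower) auto
        then show ?thesis using r by simp
      qed
    qed
  qed
  then show ?thesis by (simp add: gamma_beta_def S_def G_def I_def)
qed

end

section \<open>The theorem, by cases of the arithmetic condition\<close>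

theorem theorem2:
  fixes a b :: int and \<beta> \<beta>' :: real
  assumes "a \<ge> b" and "b \<ge> 1"
    and "\<beta> > 1" and "\<beta>\<^sup>2 = of_int a * \<beta> + of_int b"
    and "\<beta>' = of_int a - \<beta>"
    and "of_int a > (1 + sqrt 5) / 2 * of_int b \<or> a = b \<or> gcd a b = 1"
  shows "gamma_beta \<beta> b =
    max 0 (1 + (INF j :: int. P_word (beta_adic \<beta> b (of_int j)) \<beta>'))"
proof -
  define c where "c = \<beta> - of_int a"
  have sq: "\<beta> * \<beta> = of_int a * \<beta> + of_int b" using assms(4) by (simp add: power2_eq_square)
  have bc: "\<beta> * c = of_int b" using sq by (simp add: c_def algebra_simps)
  have "0 < \<beta> * c" using bc assms(2) by simp
  then have c0: "0 < c" using assms(3) by (simp add: zero_less_mult_iff)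
  have c1: "c < 1"
  proof (rule ccontr)
    assume "\<not> c < 1"
    then have "of_int a + 1 \<le> \<beta>" by (simp add: c_def)
    moreover have "\<beta> * 1 \<le> \<beta> * c" using \<open>\<not> c < 1\<close> assms(3) by (intro mult_left_mono) auto
    ultimately have "of_int a + 1 \<le> real_of_int b" using bc by linarith
    then show False using assms(1) by linarith
  qed
  interpret quad a b \<beta> c
    using assms(1,2) c0 c1 bc by unfold_locales (auto simp: c_def)
  have low: "of_int q * quad_lattice.lower a b \<beta> c q qi m 0 \<le> of_int m"
    if ql: "quad_lattice a b \<beta> c q qi" and m: "0 \<le> m"
      and lt: "of_int m < of_int q * (1 + (INF j. fint j))" for q qi m
  proof -
    interpret quad_lattice a b \<beta> c q qi by (rule ql)
    have pos: "0 < 1 + (INF j. fint j)"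
    proof -
      have "0 < of_int q * (1 + (INF j. fint j))" using m lt by linarith
      then show ?thesis using q_pos by (simp add: zero_less_mult_iff)
    qed
    have "b = 1 \<or> 2 \<le> b" using assms(2) by linarith
    then consider "of_int a > (1 + sqrt 5) / 2 * of_int b" | "a = b" | "coprime a b" "b = 1"
      | "coprime a b" "2 \<le> b"
      using assms(6) unfolding coprime_iff_gcd_eq_1 by blast
    then show ?thesis
    proof cases
      case 1
      then show ?thesis using f_le_golden m by (intro lower_le) auto
    next
      case 2
      then show ?thesis using m lt by (rule lower_le_diagonal)
    next
      case 3
      then show ?thesis using f_le_small m by (intro lower_le) auto
    next
      case 4
      then show ?thesis using f_le_coprime pos m by (intro lower_le) auto
    qed
  qed
  have "\<beta>' = - c" using assms(5) by (simp add: c_def)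
  then show ?thesis using gamma_beta_eq[OF low] by (simp add: P_word_beta_adic)
qed

end
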